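(* Let $\mathbb{K}=\bigcup_{m\ge 1}\mathbb{R}((t^{1/m}))$ and let $I\subseteq\mathbb{K}[x_1,\ldots,x_n]$ be the ideal of an affine space $V$ in $(\mathbb{K}^* )^n$. Then the affine polynomials in $I$ with minimal support (one for each minimal support, as such a polynomial is unique up to multiplication by a nonzero constant) form a real tropical basis of $I$.
   Context: $\mathbb{K}$ is the real closed field of real Puiseux series; the valuation $v(x)\in\mathbb{Q}$ of $x\in\mathbb{K}^*$ is the least exponent of $t$ occurring in $x$, and $x>0$ iff the coefficient of its least-exponent term is positive. Put $\mathbb{TR}=\{1,-1\}\times\mathbb{R}$ (with the product topology) and $trop:\mathbb{K}^*\to\mathbb{TR}$, $trop(x)=(s(x),v(x))$ with $s(x)=\pm1$ the sign of $x$; $trop$ is applied component-wise on $(\mathbb{K}^* )^n$. For $a=(\sigma,\alpha)\in\mathbb{TR}$ write $s(a)=\sigma$ and $|a|=\alpha$; for $p\in\mathbb{TR}^n$, $|p|=(|p_1|,\ldots,|p_n|)$. An affine space $V$ is a nonempty affine subspace of $\mathbb{K}^n$, whose points in the torus $(\mathbb{K}^* )^n$ are considered for tropicalization; its ideal $I$ is the ideal generated by the polynomials of degree at most $1$ vanishing on $V$. An affine polynomial is a nonzero polynomial of degree at most $1$; it has minimal support in $I$ if no affine polynomial of $I$ has support strictly contained in its support. For an ideal $I$, $\mathcal{V}(I)$ is its set of zeros with coordinates in $\mathbb{K}$, and $trop(\mathcal{V}(I))$ denotes the closure in $\mathbb{TR}^n$ of the image under $trop$ of $\mathcal{V}(I)\cap(\mathbb{K}^*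 )^n$. For a polynomial $F=\sum_{\ell\in A}a_\ell x^\ell$ with support $A$ (all $a_\ell\ne0$), $\mathcal{T}_{\mathbb{R}}(F)\subseteq\mathbb{TR}^n$ is the set of points $p$ for which there are two exponents $i\neq j$ in $A$, both attaining $\min_{\ell\in A}\big(v(a_\ell)+\langle \ell,|p|\rangle\big)$, such that $s(a_i)\prod_{k=1}^n s(p_k)^{i_k}=1$ and $s(a_j)\prod_{k=1}^n s(p_k)^{j_k}=-1$. A real tropical basis of $I$ is a finite set $\{F_1,\ldots,F_r\}$ generating $I$ such that $trop(\mathcal{V}(I))=\bigcap_{i=1}^r\mathcal{T}_{\mathbb{R}}(F_i)$ (an empty intersection being $\mathbb{TR}^n$). *)

theory Defs
  imports
    "HOL-Analysis.Analysis"
    "HOL-Computational_Algebra.Formal_Laurent_Series"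
    "HOL-Library.Poly_Mapping"
begin

no_notation fps_nth (infixl "$" 75)

section \<open>The field of real Puiseux series\<close>

text \<open>
  The element \<^term>\<open>x\<close> of \<open>\<Union>m\<ge>1. \<real>((t\<^bsup>1/m\<^esup>))\<close> is represented by its coefficient
  function: \<open>pcoeff x q\<close> is the coefficient of \<open>t\<^bsup>q\<^esup>\<close>.
\<close>

typedef puiseux = "{f :: rat \<Rightarrow> real. \<exists>m::nat. m > 0 \<and> (\<exists>N. \<forall>q. f q \<noteq> 0 \<longrightarrow> of_nat m * q \<in> \<int> \<and> N \<le> q)}"
  morphisms pcoeff Abs_puiseux
  by (rule exI[of _ "\<lambda>_. 0"]) auto

setup_lifting type_definition_puiseux

lemma puiseux_eqI: "(\<And>q. pcoeff x q = pcoeff y q) \<Longrightarrow> x = y"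
  by (simp add: pcoeff_inject[symmetric] fun_eq_iff)

lemma puiseux_common_denom:
  assumes "\<exists>m::nat. m > 0 \<and> (\<exists>N. \<forall>q. f q \<noteq> (0::real) \<longrightarrow> of_nat m * q \<in> \<int> \<and> N \<le> q)"
    and "\<exists>m::nat. m > 0 \<and> (\<exists>N. \<forall>q. g q \<noteq> (0::real) \<longrightarrow> of_nat m * q \<in> \<int> \<and> N \<le> q)"
  obtains m :: nat and N :: rat where "m > 0"
    "\<And>q. f q \<noteq> 0 \<Longrightarrow> of_nat m * q \<in> \<int> \<and> N \<le> q"
    "\<And>q. g q \<noteq> 0 \<Longrightarrow> of_nat m * q \<in> \<int> \<and> N \<le> q"
proof -
  from assms obtain m1 m2 :: nat and N1 N2 :: rat where
    *: "m1 > 0" "m2 > 0" "\<And>q. f q \<noteq> 0 \<Longrightarrow> of_nat m1 * q \<in> \<int> \<and> N1 \<le> q"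
    "\<And>q. g q \<noteq> 0 \<Longrightarrow> of_nat m2 * q \<in> \<int> \<and> N2 \<le> q" by blast
  show ?thesis
  proof (rule that[of "m1 * m2" "min N1 N2"])
    show "of_nat (m1 * m2) * q \<in> \<int> \<and> min N1 N2 \<le> q" if "f q \<noteq> 0" for q
      using *(3)[OF that] Ints_mult[of "of_nat m2" "of_nat m1 * q"]
      by (auto simp: algebra_simps)
    show "of_nat (m1 * m2) * q \<in> \<int> \<and> min N1 N2 \<le> q" if "g q \<noteq> 0" for q
      using *(4)[OF that] Ints_mult[of "of_nat m1" "of_nat m2 * q"]
      by (auto simp: algebra_simps)
  qed (use * in auto)
qed

instantiation puiseux :: "{zero, one, plus, minus, uminus, times}"
begin

lift_definition zero_puiseux :: puiseux is "\<lambda>_. 0"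
  by (rule exI[of _ 1]) simp

lift_definition one_puiseux :: puiseux is "\<lambda>q. if q = 0 then 1 else 0"
  by (rule exI[of _ 1], intro conjI exI[of _ 0]) simp_all

lift_definition plus_puiseux :: "puiseux \<Rightarrow> puiseux \<Rightarrow> puiseux" is "\<lambda>f g q. f q + g q"
proof (erule puiseux_common_denom, assumption)
  fix f g :: "rat \<Rightarrow> real" and m :: nat and N :: rat
  assume m: "m > 0" and f: "\<And>q. f q \<noteq> 0 \<Longrightarrow> of_nat m * q \<in> \<int> \<and> N \<le> q"
    and g: "\<And>q. g q \<noteq> 0 \<Longrightarrow> of_nat m * q \<in> \<int> \<and> N \<le> q"
  have "of_nat m * q \<in> \<int> \<and> N \<le> q" if "f q + g q \<noteq> 0" for q
    using that f[of q] g[of q] by (cases "f q = 0") simp_all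
  with m show "\<exists>m::nat. m > 0 \<and> (\<exists>N. \<forall>q. f q + g q \<noteq> 0 \<longrightarrow> of_nat m * q \<in> \<int> \<and> N \<le> q)"
    by blast
qed

lift_definition minus_puiseux :: "puiseux \<Rightarrow> puiseux \<Rightarrow> puiseux" is "\<lambda>f g q. f q - g q"
proof (erule puiseux_common_denom, assumption)
  fix f g :: "rat \<Rightarrow> real" and m :: nat and N :: rat
  assume m: "m > 0" and f: "\<And>q. f q \<noteq> 0 \<Longrightarrow> of_nat m * q \<in> \<int> \<and> N \<le> q"
    and g: "\<And>q. g q \<noteq> 0 \<Longrightarrow> of_nat m * q \<in> \<int> \<and> N \<le> q"
  have "of_nat m * q \<in> \<int> \<and> N \<le> q" if "f q - g q \<noteq> 0" for q
    using that f[of q] g[of q] by (cases "f q = 0") simp_all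
  with m show "\<exists>m::nat. m > 0 \<and> (\<exists>N. \<forall>q. f q - g q \<noteq> 0 \<longrightarrow> of_nat m * q \<in> \<int> \<and> N \<le> q)"
    by blast
qed

lift_definition uminus_puiseux :: "puiseux \<Rightarrow> puiseux" is "\<lambda>f q. - f q"
  by (simp only: neg_equal_0_iff_equal)

lift_definition times_puiseux :: "puiseux \<Rightarrow> puiseux \<Rightarrow> puiseux" is
  "\<lambda>f g q. \<Sum>a | f a \<noteq> 0 \<and> g (q - a) \<noteq> 0. f a * g (q - a)"
proof (erule puiseux_common_denom, assumption)
  fix f g :: "rat \<Rightarrow> real" and m :: nat and N :: rat
  assume m: "m > 0" and f: "\<And>q. f q \<noteq> 0 \<Longrightarrow> of_nat m * q \<in> \<int> \<and> N \<le> q"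
    and g: "\<And>q. g q \<noteq> 0 \<Longrightarrow> of_nat m * q \<in> \<int> \<and> N \<le> q"
  have "of_nat m * q \<in> \<int> \<and> N + N \<le> q"
    if "(\<Sum>a | f a \<noteq> 0 \<and> g (q - a) \<noteq> 0. f a * g (q - a)) \<noteq> 0" for q
  proof -
    have "{a. f a \<noteq> 0 \<and> g (q - a) \<noteq> 0} \<noteq> {}"
      using that by (metis (no_types) sum.empty)
    then obtain a where "f a \<noteq> 0" "g (q - a) \<noteq> 0" by blast
    with f[of a] g[of "q - a"] Ints_add[of "of_nat m * a" "of_nat m * (q - a)"]
    show ?thesis by (auto simp: algebra_simps)
  qed
  with m show "\<exists>m::nat. m > 0 \<and> (\<exists>N. \<forall>q. (\<Sum>a | f a \<noteq> 0 \<and> g (q - a) \<noteq> 0. f a * g (q - a)) \<noteq> 0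
      \<longrightarrow> of_nat m * q \<in> \<int> \<and> N \<le> q)"
    by blast
qed

instance ..

end

text \<open>The embedding \<open>g \<mapsto> g(t\<^bsup>1/m\<^esup>)\<close> of the formal Laurent series, for \<open>m > 0\<close>.\<close>

lift_definition puiseux_of_fls :: "nat \<Rightarrow> real fls \<Rightarrow> puiseux" is
  "\<lambda>m g q. if m > 0 \<and> of_nat m * q \<in> \<int> then fls_nth g \<lfloor>of_nat m * q\<rfloor> else 0"
proof -
  fix m :: nat and g :: "real fls"
  let ?f = "\<lambda>q::rat. if m > 0 \<and> of_nat m * q \<in> \<int> then fls_nth g \<lfloor>of_nat m * q\<rfloor> else 0"
  show "\<exists>m::nat. m > 0 \<and> (\<exists>N. \<forall>q. ?f q \<noteq> 0 \<longrightarrow> of_nat m * q \<in> \<int> \<and> N \<le> q)"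
  proof (cases "m > 0")
    case True
    have "of_nat m * q \<in> \<int> \<and> of_int (fls_subdegree g) / of_nat m \<le> q" if "?f q \<noteq> 0" for q
    proof -
      from that have *: "of_nat m * q \<in> \<int>" "fls_nth g \<lfloor>of_nat m * q\<rfloor> \<noteq> 0"
        by (auto split: if_splits)
      from fls_subdegree_leI[OF *(2)] have "of_int (fls_subdegree g) \<le> of_nat m * q"
        by (simp add: le_floor_iff)
      with * True show ?thesis by (simp add: field_simps)
    qed
    with True show ?thesis by blast
  qed auto
qed

lemma puiseux_of_fls_surj:
  obtains m where "m > 0" "\<And>k. k > 0 \<Longrightarrow> \<exists>g. x = puiseux_of_fls (m * k) g"
proof -
  obtain m :: nat and N where m: "m > 0"
    and x: "\<And>q. pcoeff x q \<noteq> 0 \<Longrightarrow> of_nat m * q \<in> \<int> \<and> N \<le> q"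
    using pcoeff[of x] by auto
  show ?thesis
  proof (rule that[OF m])
    fix k :: nat assume k: "k > 0"
    define g where "g = Abs_fls (\<lambda>n. pcoeff x (of_int n / of_nat (m * k)))"
    have "\<forall>n < \<lfloor>N * of_nat (m * k)\<rfloor>. pcoeff x (of_int n / of_nat (m * k)) = 0"
    proof (intro allI impI, rule ccontr)
      fix n assume "n < \<lfloor>N * of_nat (m * k)\<rfloor>"
      and "pcoeff x (of_int n / of_nat (m * k)) \<noteq> 0"
      with x[of "of_int n / of_nat (m * k)"] m k have "N * of_nat (m * k) \<le> of_int n"
        by (simp add: field_simps)
      with \<open>n < _\<close> show False by linarith
    qed
    then have g: "fls_nth g n = pcoeff x (of_int n / of_nat (m * k))" for n
      unfolding g_def by (intro nth_Abs_fls_ex_lower_bound) blast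
    have "pcoeff x q = pcoeff (puiseux_of_fls (m * k) g) q" for q
    proof (cases "of_nat (m * k) * q \<in> \<int>")
      case True
      then obtain n where n: "of_nat (m * k) * q = of_int n" by (auto elim: Ints_cases)
      then have "q = of_int n / of_nat (m * k)" using m k by (simp add: field_simps)
      with n m k show ?thesis by (simp add: puiseux_of_fls.rep_eq g)
    next
      case False
      then have "of_nat m * q \<notin> \<int>"
        using Ints_mult[of "of_nat k" "of_nat m * q"] by (auto simp: algebra_simps)
      with x[of q] False show ?thesis by (auto simp: puiseux_of_fls.rep_eq)
    qed
    then show "\<exists>g. x = puiseux_of_fls (m * k) g" by (blast intro: puiseux_eqI)
  qed
qed

lemma puiseux_of_fls_cases3:
  fixes x y z :: puiseux
  obtains m f g h where "m > 0" "x = puiseux_of_fls m f" "y = puiseux_of_fls m g" "z = puiseux_of_fls m h"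
proof -
  obtain m1 where m1: "m1 > 0" "\<And>k. k > 0 \<Longrightarrow> \<exists>g. x = puiseux_of_fls (m1 * k) g"
    using puiseux_of_fls_surj[of x] by blast
  obtain m2 where m2: "m2 > 0" "\<And>k. k > 0 \<Longrightarrow> \<exists>g. y = puiseux_of_fls (m2 * k) g"
    using puiseux_of_fls_surj[of y] by blast
  obtain m3 where m3: "m3 > 0" "\<And>k. k > 0 \<Longrightarrow> \<exists>g. z = puiseux_of_fls (m3 * k) g"
    using puiseux_of_fls_surj[of z] by blast
  have "\<exists>f. x = puiseux_of_fls (m1 * m2 * m3) f" using m1(2)[of "m2 * m3"] m2(1) m3(1) by (simp add: mult_ac)
  moreover have "\<exists>f. y = puiseux_of_fls (m1 * m2 * m3) f"
    using m2(2)[of "m1 * m3"] m1(1) m3(1) by (simp add: mult_ac)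
  moreover have "\<exists>f. z = puiseux_of_fls (m1 * m2 * m3) f"
    using m3(2)[of "m1 * m2"] m1(1) m2(1) by (simp add: mult_ac)
  moreover have "m1 * m2 * m3 > 0" using m1(1) m2(1) m3(1) by simp
  ultimately show ?thesis using that by blast
qed

lemma pcoeff_puiseux_of_fls:
  "m > 0 \<Longrightarrow> pcoeff (puiseux_of_fls m g) (of_int n / of_nat m) = fls_nth g n"
  by (simp add: puiseux_of_fls.rep_eq)

lemma puiseux_of_fls_inject: "m > 0 \<Longrightarrow> puiseux_of_fls m f = puiseux_of_fls m g \<longleftrightarrow> f = g"
  using pcoeff_puiseux_of_fls[of m f] pcoeff_puiseux_of_fls[of m g] by (auto intro: fls_eqI)

lemma puiseux_of_fls_0: "puiseux_of_fls m 0 = 0"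
  by transfer auto

lemma puiseux_of_fls_1: "m > 0 \<Longrightarrow> puiseux_of_fls m 1 = 1"
proof (rule puiseux_eqI)
  fix q :: rat
  assume "m > 0"
  then show "pcoeff (puiseux_of_fls m 1) q = pcoeff 1 q"
    by (auto simp: puiseux_of_fls.rep_eq one_puiseux.rep_eq elim!: Ints_cases)
qed

lemma puiseux_of_fls_add: "puiseux_of_fls m f + puiseux_of_fls m g = puiseux_of_fls m (f + g)"
  by transfer auto

lemma puiseux_of_fls_diff: "puiseux_of_fls m f - puiseux_of_fls m g = puiseux_of_fls m (f - g)"
  by transfer auto

lemma puiseux_of_fls_uminus: "- puiseux_of_fls m f = puiseux_of_fls m (- f)"
  by transfer auto

lemma puiseux_of_fls_mult:
  assumes m: "m > 0"
  shows "puiseux_of_fls m f * puiseux_of_fls m g = puiseux_of_fls m (f * g)"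
proof (rule puiseux_eqI)
  fix q
  let ?x = "puiseux_of_fls m f" and ?y = "puiseux_of_fls m g"
  let ?A = "{a. pcoeff ?x a \<noteq> 0 \<and> pcoeff ?y (q - a) \<noteq> 0}"
  have Z: "of_nat m * a \<in> \<int>" if "pcoeff (puiseux_of_fls m h) a \<noteq> 0" for h a
    using that by (auto simp: puiseux_of_fls.rep_eq split: if_splits)
  have "(\<Sum>a\<in>?A. pcoeff ?x a * pcoeff ?y (q - a)) = pcoeff (puiseux_of_fls m (f * g)) q"
  proof (cases "of_nat m * q \<in> \<int>")
    case False
    have "a \<notin> ?A" for a
    proof
      assume "a \<in> ?A"
      then have "of_nat m * a + of_nat m * (q - a) \<in> \<int>" by (intro Ints_add Z) auto
      with False show False by (simp add: algebra_simps)
    qed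
    then have A: "?A = {}" by blast
    show ?thesis
      unfolding A using False by (simp add: puiseux_of_fls.rep_eq)
  next
    case True
    then obtain n where "of_nat m * q = of_int n" by (auto elim: Ints_cases)
    with m have q: "q = of_int n / of_nat m" by (simp add: field_simps)
    have y: "pcoeff ?y (q - of_int i / of_nat m) = fls_nth g (n - i)" for i
      using pcoeff_puiseux_of_fls[OF m, of g "n - i"] by (simp add: q diff_divide_distrib)
    let ?B = "{i. fls_nth f i \<noteq> 0 \<and> fls_nth g (n - i) \<noteq> 0}"
    have A: "?A = (\<lambda>i. of_int i / of_nat m) ` ?B"
    proof (intro equalityI subsetI)
      fix a assume a: "a \<in> ?A"
      then have "of_nat m * a \<in> \<int>" using Z by blast
      then obtain i where "of_nat m * a = of_int i" by (auto elim: Ints_cases)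
      with m have "a = of_int i / of_nat m" by (simp add: field_simps)
      with a show "a \<in> (\<lambda>i. of_int i / of_nat m) ` ?B"
        by (auto simp: y pcoeff_puiseux_of_fls m)
    qed (auto simp: y pcoeff_puiseux_of_fls m)
    have "inj_on (\<lambda>i. of_int i / of_nat m :: rat) ?B"
      using m by (auto simp: inj_on_def)
    then have "(\<Sum>a\<in>?A. pcoeff ?x a * pcoeff ?y (q - a)) = (\<Sum>i\<in>?B. fls_nth f i * fls_nth g (n - i))"
      unfolding A by (subst sum.reindex) (auto simp: y pcoeff_puiseux_of_fls m)
    also have "\<dots> = (\<Sum>i = fls_subdegree f..n - fls_subdegree g. fls_nth f i * fls_nth g (n - i))"
    proof (rule sum.mono_neutral_left)
      show "?B \<subseteq> {fls_subdegree f..n - fls_subdegree g}"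
        using fls_subdegree_leI by fastforce
    qed auto
    also have "\<dots> = fls_nth (f * g) n" by (simp add: fls_times_nth(2))
    finally show ?thesis by (simp add: q pcoeff_puiseux_of_fls m)
  qed
  then show "pcoeff (?x * ?y) q = pcoeff (puiseux_of_fls m (f * g)) q"
    by (simp add: times_puiseux.rep_eq)
qed

lemmas puiseux_of_fls_hom =
  puiseux_of_fls_add puiseux_of_fls_diff puiseux_of_fls_uminus puiseux_of_fls_mult

instance puiseux :: comm_ring_1
proof
  fix x y z :: puiseux
  obtain m f g h where m: "m > 0"
    and *: "x = puiseux_of_fls m f" "y = puiseux_of_fls m g" "z = puiseux_of_fls m h"
    by (rule puiseux_of_fls_cases3)
  show "x + y + z = x + (y + z)" "x + y = y + x" "0 + x = x" "- x + x = 0" "x - y = x + - y"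
    by (transfer, simp add: fun_eq_iff)+
  show "x * y * z = x * (y * z)" "x * y = y * x" "(x + y) * z = x * z + y * z"
    using m unfolding * by (simp_all add: puiseux_of_fls_hom algebra_simps)
  show "1 * x = x"
    using m unfolding * puiseux_of_fls_1[OF m, symmetric] by (simp add: puiseux_of_fls_hom)
  show "(0::puiseux) \<noteq> 1"
    by transfer (auto simp: fun_eq_iff)
qed

instantiation puiseux :: field
begin

definition inverse_puiseux :: "puiseux \<Rightarrow> puiseux" where
  "inverse x = (if x = 0 then 0 else THE y. x * y = 1)" for x :: puiseux

definition divide_puiseux :: "puiseux \<Rightarrow> puiseux \<Rightarrow> puiseux" where
  "x div y = x * inverse y" for x y :: puiseux

instance
proof
  fix x y :: puiseux
  show "inverse x * x = 1" if "x \<noteq> 0"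
  proof -
    obtain m f where m: "m > 0" and x: "x = puiseux_of_fls m f"
      by (rule puiseux_of_fls_cases3)
    with that have "f \<noteq> 0" by (auto simp: puiseux_of_fls_0)
    then have *: "x * puiseux_of_fls m (inverse f) = 1"
      using m by (simp add: x puiseux_of_fls_hom puiseux_of_fls_1)
    have "(THE y. x * y = 1) = puiseux_of_fls m (inverse f)"
    proof (rule the_equality, fact *)
      fix y assume "x * y = 1"
      then show "y = puiseux_of_fls m (inverse f)"
        using * by (metis mult.assoc mult.commute mult_1)
    qed
    with * that show ?thesis by (simp add: inverse_puiseux_def mult.commute)
  qed
qed (simp_all add: divide_puiseux_def inverse_puiseux_def)

end

definition val :: "puiseux \<Rightarrow> rat" where
  "val x = (LEAST q. pcoeff x q \<noteq> 0)"

abbreviation lead :: "puiseux \<Rightarrow> real" where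
  "lead x \<equiv> pcoeff x (val x)"

lemma val_puiseux_of_fls:
  assumes "m > 0" "g \<noteq> 0"
  shows "val (puiseux_of_fls m g) = of_int (fls_subdegree g) / of_nat m"
  unfolding val_def
proof (rule Least_equality)
  show "pcoeff (puiseux_of_fls m g) (of_int (fls_subdegree g) / of_nat m) \<noteq> 0"
    using assms by (simp add: pcoeff_puiseux_of_fls)
next
  fix q assume "pcoeff (puiseux_of_fls m g) q \<noteq> 0"
  then obtain n where "of_nat m * q = of_int n" and n: "fls_nth g \<lfloor>of_nat m * q\<rfloor> \<noteq> 0"
    by (auto simp: puiseux_of_fls.rep_eq split: if_splits elim: Ints_cases)
  then show "of_int (fls_subdegree g) / of_nat m \<le> q"
    using fls_subdegree_leI[OF n] \<open>m > 0\<close> by (simp add: field_simps)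
qed

lemma lead_puiseux_of_fls:
  assumes "m > 0"
  shows "lead (puiseux_of_fls m g) = fls_nth g (fls_subdegree g)"
proof (cases "g = 0")
  case True
  then show ?thesis by (simp add: puiseux_of_fls_0 zero_puiseux.rep_eq)
qed (simp add: assms val_puiseux_of_fls pcoeff_puiseux_of_fls)

lemma lead_0 [simp]: "lead 0 = 0"
  by (simp add: zero_puiseux.rep_eq)

lemma lead_eq_0_iff [simp]: "lead x = 0 \<longleftrightarrow> x = 0"
proof -
  obtain m f where "m > 0" "x = puiseux_of_fls m f"
    by (rule puiseux_of_fls_cases3)
  then show ?thesis
    by (cases "f = 0")
       (simp_all add: lead_puiseux_of_fls puiseux_of_fls_inject flip: puiseux_of_fls_0[of m])
qed

lemma lead_mult: "lead (x * y) = lead x * lead y"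
proof -
  obtain m f g where "m > 0" "x = puiseux_of_fls m f" "y = puiseux_of_fls m g"
    by (rule puiseux_of_fls_cases3)
  then show ?thesis
    by (cases "f = 0 \<or> g = 0") (auto simp: lead_puiseux_of_fls puiseux_of_fls_mult)
qed

lemma lead_uminus: "lead (- x) = - lead x"
  by (simp add: val_def uminus_puiseux.rep_eq)

lemma lead_add_pos:
  assumes "lead x > 0" "lead y > 0"
  shows "lead (x + y) > 0"
proof -
  obtain m f g where m: "m > 0" and xy: "x = puiseux_of_fls m f" "y = puiseux_of_fls m g"
    by (rule puiseux_of_fls_cases3[of x y])
  let ?f = "fls_subdegree f" and ?g = "fls_subdegree g"
  from assms have *: "fls_nth f ?f > 0" "fls_nth g ?g > 0"
    by (simp_all add: xy lead_puiseux_of_fls m)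
  have pos: "fls_nth (f + g) (min ?f ?g) > 0"
    using * by (cases ?f ?g rule: linorder_cases) auto
  have "fls_subdegree (f + g) = min ?f ?g"
    using pos by (intro fls_subdegree_eqI) auto
  with pos show ?thesis by (simp add: xy puiseux_of_fls_add lead_puiseux_of_fls m)
qed

instantiation puiseux :: linordered_field
begin

text \<open>In this order \<open>x > 0\<close> iff the coefficient of the least-exponent term of \<open>x\<close> is positive.\<close>

definition less_puiseux :: "puiseux \<Rightarrow> puiseux \<Rightarrow> bool" where
  "x < y \<longleftrightarrow> lead (y - x) > 0"

definition less_eq_puiseux :: "puiseux \<Rightarrow> puiseux \<Rightarrow> bool" where
  "x \<le> y \<longleftrightarrow> x < y \<or> x = y" for x y :: puiseux

definition abs_puiseux :: "puiseux \<Rightarrow> puiseux" where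
  "\<bar>x\<bar> = (if x < 0 then - x else x)" for x :: puiseux

definition sgn_puiseux :: "puiseux \<Rightarrow> puiseux" where
  "sgn x = (if x = 0 then 0 else if 0 < x then 1 else - 1)" for x :: puiseux

instance
proof
  fix x y z :: puiseux
  have trans: "x < z" if "x < y" "y < z" for x y z :: puiseux
    using lead_add_pos[of "y - x" "z - y"] that by (simp add: less_puiseux_def)
  have irrefl: "\<not> x < x" for x :: puiseux by (simp add: less_puiseux_def)
  show "x < y \<longleftrightarrow> x \<le> y \<and> \<not> y \<le> x"
    unfolding less_eq_puiseux_def using trans irrefl by metis
  show "x \<le> x" by (simp add: less_eq_puiseux_def)
  show "x \<le> z" if "x \<le> y" "y \<le> z"
    using that trans unfolding less_eq_puiseux_def by metis
  show "x = y" if "x \<le> y" "y \<le> x"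
    using that trans irrefl unfolding less_eq_puiseux_def by metis
  show "x \<le> y \<or> y \<le> x"
  proof (cases "x = y")
    case False
    then have "lead (x - y) \<noteq> 0" by simp
    moreover have "lead (y - x) = - lead (x - y)" using lead_uminus[of "x - y"] by simp
    ultimately show ?thesis by (auto simp: less_eq_puiseux_def less_puiseux_def simp del: lead_eq_0_iff)
  qed (simp add: less_eq_puiseux_def)
  show "z + x \<le> z + y" if "x \<le> y"
    using that by (auto simp: less_eq_puiseux_def less_puiseux_def)
  show "z * x < z * y" if "x < y" "0 < z"
    using that lead_mult[of z "y - x"] by (simp add: less_puiseux_def right_diff_distrib)
  show "\<bar>x\<bar> = (if x < 0 then - x else x)" by (rule abs_puiseux_def)
  show "sgn x = (if x = 0 then 0 else if 0 < x then 1 else - 1)" by (rule sgn_puiseux_def)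
qed

end


section \<open>Tropicalization\<close>

text \<open>
  A point of the real tropical space has components in \<open>{1, -1} \<times> \<real>\<close>, realized as a subset of
  \<^typ>\<open>int \<times> real\<close>.  The topology of \<^typ>\<open>int\<close> is discrete and that of \<open>\<times>\<close> and \<open>^\<close> is the product
  topology, so \<open>TR\<close> carries the intended topology as a subspace.
\<close>

type_synonym 'n trop_point = "((int \<times> real), 'n) vec"

definition TR :: "'n::finite trop_point set" where
  "TR = {p. \<forall>k. fst (p $ k) \<in> {1, -1}}"

definition psign :: "puiseux \<Rightarrow> int" where
  "psign x = (if x > 0 then 1 else - 1)"

definition trop :: "(puiseux, 'n::finite) vec \<Rightarrow> 'n trop_point" where
  "trop x = (\<chi> k. (psign (x $ k), real_of_rat (val (x $ k))))"


section \<open>Polynomials and ideals\<close>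

type_synonym 'n exponent = "(nat, 'n) vec"
type_synonym 'n mpoly = "'n exponent \<Rightarrow>\<^sub>0 puiseux"

definition mpoly_eval :: "'n::finite mpoly \<Rightarrow> puiseux ^ 'n \<Rightarrow> puiseux" where
  "mpoly_eval F x = (\<Sum>l\<in>Poly_Mapping.keys F. Poly_Mapping.lookup F l * (\<Prod>k\<in>UNIV. x $ k ^ (l $ k)))"

text \<open>The total degree, with \<open>total_degree 0 = 0\<close>.\<close>

definition total_degree :: "'n::finite mpoly \<Rightarrow> nat" where
  "total_degree F = Max (insert 0 ((\<lambda>l. \<Sum>k\<in>UNIV. l $ k) ` Poly_Mapping.keys F))"

definition affine_poly :: "'n::finite mpoly \<Rightarrow> bool" where
  "affine_poly F \<longleftrightarrow> F \<noteq> 0 \<and> total_degree F \<le> 1"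

text \<open>The ideal generated by \<open>S\<close> is \<open>ideal.span S\<close>.\<close>

interpretation ideal: module "(*) :: 'a::comm_ring_1 \<Rightarrow> 'a \<Rightarrow> 'a"
  by standard (simp_all add: algebra_simps)

definition zeros :: "'n::finite mpoly set \<Rightarrow> (puiseux ^ 'n) set" where
  "zeros I = {x. \<forall>F\<in>I. mpoly_eval F x = 0}"

definition affine_space :: "(puiseux ^ 'n::finite) set \<Rightarrow> bool" where
  "affine_space V \<longleftrightarrow> (\<exists>a W. vec.subspace W \<and> V = (\<lambda>w. a + w) ` W)"

definition affine_ideal :: "(puiseux ^ 'n::finite) set \<Rightarrow> 'n mpoly set" where
  "affine_ideal V = ideal.span {F. total_degree F \<le> 1 \<and> (\<forall>x\<in>V. mpoly_eval F x = 0)}"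

definition minimal_support :: "'n::finite mpoly set \<Rightarrow> 'n mpoly \<Rightarrow> bool" where
  "minimal_support I F \<longleftrightarrow> F \<in> I \<and> affine_poly F \<and>
     \<not> (\<exists>G\<in>I. affine_poly G \<and> Poly_Mapping.keys G \<subset> Poly_Mapping.keys F)"


section \<open>Real tropical bases\<close>

definition trop_variety :: "'n::finite mpoly set \<Rightarrow> 'n trop_point set" where
  "trop_variety I = top_of_set TR closure_of (trop ` {x \<in> zeros I. \<forall>k. x $ k \<noteq> 0})"

text \<open>The valuation and the sign of the term of \<open>F\<close> with exponent \<open>l\<close> at \<open>p\<close>.\<close>

definition term_val :: "'n::finite mpoly \<Rightarrow> 'n trop_point \<Rightarrow> 'n exponent \<Rightarrow> real" where
  "term_val F p l = real_of_rat (val (Poly_Mapping.lookup F l)) + (\<Sum>k\<in>UNIV. real (l $ k) * snd (p $ k))"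

definition term_sign :: "'n::finite mpoly \<Rightarrow> 'n trop_point \<Rightarrow> 'n exponent \<Rightarrow> int" where
  "term_sign F p l = psign (Poly_Mapping.lookup F l) * (\<Prod>k\<in>UNIV. fst (p $ k) ^ (l $ k))"

definition trop_hypersurface :: "'n::finite mpoly \<Rightarrow> 'n trop_point set" where
  "trop_hypersurface F = {p \<in> TR. \<exists>i\<in>Poly_Mapping.keys F. \<exists>j\<in>Poly_Mapping.keys F. i \<noteq> j \<and>
     term_val F p i = Min (term_val F p ` Poly_Mapping.keys F) \<and>
     term_val F p j = Min (term_val F p ` Poly_Mapping.keys F) \<and>
     term_sign F p i = 1 \<and> term_sign F p j = - 1}"

definition real_tropical_basis :: "'n::finite mpoly set \<Rightarrow> 'n mpoly set \<Rightarrow> bool" where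
  "real_tropical_basis B I \<longleftrightarrow> finite B \<and> ideal.span B = I \<and>
     trop_variety I = TR \<inter> (\<Inter>F\<in>B. trop_hypersurface F)"

end

theory Submission
  imports Defs
begin

text \<open>
  The sign of a term of minimal valuation cannot be cancelled by the others, so a point of the torus on
  which an affine polynomial vanishes tropicalizes into its real tropical hypersurface, which is closed.

  Conversely, let \<open>p\<close> lie in the hypersurfaces of all affine polynomials of \<open>I\<close> with minimal support, and
  take rationals \<open>b k < \<bar>p k\<bar> < a k\<close> close to \<open>\<bar>p k\<bar>\<close>.  It suffices to find a zero of \<open>I\<close> in the box with
  corners \<open>s(p k) t\<^bsup>a k\<^esup>\<close> and \<open>s(p k) t\<^bsup>b k\<^esup>\<close>.  The coefficient vectors of the affine polynomials with minimal
  support are the elementary vectors of a linear space, and Rockafellar's theorem, valid over every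
  ordered field, yields such a zero as soon as no elementary vector is negative on the whole box.  This
  holds because each of them attains both signs on the box: a minimal term of either sign can be made
  strictly dominant.
\<close>

declare ideal.scale_scale [simp del] \<comment> \<open>it reassociates products, against \<open>mult.assoc\<close> and \<open>algebra_simps\<close>\<close>
declare One_nat_def [simp del]


section \<open>Elementary vectors over an ordered field\<close>

definition supp :: "('e \<Rightarrow> 'a::zero) \<Rightarrow> 'e set" where
  "supp y = {k. y k \<noteq> 0}"

text \<open>Two vectors that nowhere oppose the sign of \<open>y\<close> do not oppose each other
  where \<open>y\<close> is nonzero; conformal splittings rest on this.\<close>

lemma mult_nonneg_trans:
  fixes y u v :: "'a::linordered_idom"
  assumes "y \<noteq> 0" "y * u \<ge> 0" "y * v \<ge> 0"
  shows "u * v \<ge> 0"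
  using assms by (cases "y > 0") (simp_all add: zero_le_mult_iff)

text \<open>Vectors are functions on the whole index type with support inside a finite set, so
  coefficient functions of polynomials qualify as they are.\<close>

locale vector_subspace =
  fixes E :: "'e set" and L :: "('e \<Rightarrow> 'a::linordered_field) set"
  assumes finite_E: "finite E"
    and supp_subset: "y \<in> L \<Longrightarrow> supp y \<subseteq> E"
    and zero_mem: "(\<lambda>_. 0) \<in> L"
    and add_mem: "y \<in> L \<Longrightarrow> z \<in> L \<Longrightarrow> (\<lambda>k. y k + z k) \<in> L"
    and scale_mem: "y \<in> L \<Longrightarrow> (\<lambda>k. c * y k) \<in> L"
begin

text \<open>The supports of these vectors are the circuits of the matroid of linear dependencies
  given by \<open>L\<close>.\<close>

definition elementary :: "('e \<Rightarrow> 'a) \<Rightarrow> bool" where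
  "elementary y \<longleftrightarrow> y \<in> L \<and> supp y \<noteq> {} \<and> \<not> (\<exists>z\<in>L. supp z \<noteq> {} \<and> supp z \<subset> supp y)"

lemma finite_supp: "y \<in> L \<Longrightarrow> finite (supp y)"
  using supp_subset finite_E finite_subset by blast

lemma comb_mem: "y \<in> L \<Longrightarrow> z \<in> L \<Longrightarrow> (\<lambda>k. c * y k + d * z k) \<in> L"
  by (intro add_mem scale_mem)

lemma elementary_scale:
  assumes "elementary y" "c \<noteq> 0"
  shows "elementary (\<lambda>k. c * y k)"
proof -
  have "supp (\<lambda>k. c * y k) = supp y"
    using assms(2) by (simp add: supp_def)
  with assms(1) scale_mem show ?thesis
    by (simp add: elementary_def)
qed

text \<open>The combination of \<open>y\<close> and \<open>z\<close> that vanishes at one coordinate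
  of the common support has strictly smaller support, so minimality makes it zero.\<close>

lemma elementary_unique:
  assumes y: "elementary y" and z: "elementary z" and supp: "supp y = supp z"
  obtains c where "c \<noteq> 0" "z = (\<lambda>k. c * y k)"
proof -
  from y obtain e where e: "y e \<noteq> 0"
    by (auto simp: elementary_def supp_def)
  with supp have ze: "z e \<noteq> 0" by (auto simp: supp_def)
  define c where "c = z e / y e"
  define w where "w = (\<lambda>k. (- c) * y k + 1 * z k)"
  have w: "w \<in> L" unfolding w_def
    using y z by (intro comb_mem) (auto simp: elementary_def)
  have "w e = 0" using e by (simp add: w_def c_def)
  moreover have "supp w \<subseteq> supp y"
  proof
    fix k assume "k \<in> supp w"
    then have "k \<in> supp y \<or> k \<in> supp z" by (auto simp: w_def supp_def)
    with supp show "k \<in> supp y" by simp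
  qed
  ultimately have "supp w \<subset> supp y" using e by (auto simp: supp_def)
  with y w have "supp w = {}" by (auto simp: elementary_def)
  then have "w k = 0" for k by (auto simp: supp_def)
  then have "z = (\<lambda>k. c * y k)"
    by (simp add: w_def fun_eq_iff)
  moreover have "c \<noteq> 0" using e ze by (simp add: c_def)
  ultimately show ?thesis using that by blast
qed

text \<open>
  Subtracting the largest multiple of \<open>w\<close> that does not change any sign of \<open>y\<close> kills a coordinate.
\<close>

lemma conformal_reduction:
  assumes y: "y \<in> L" and w: "w \<in> L" and sub: "supp w \<subseteq> supp y" and ex: "\<exists>k. y k * w k > 0"
  obtains r where "r > 0" "\<And>k. y k * (y k - r * w k) \<ge> 0" "supp (\<lambda>k. y k - r * w k) \<subset> supp y"
proof -
  define S where "S = {k. y k * w k > 0}"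
  have S: "finite S" "S \<noteq> {}"
    using ex by (auto simp: S_def supp_def intro!: finite_subset[OF _ finite_supp[OF y]])
  define r where "r = Min ((\<lambda>k. y k / w k) ` S)"
  have "r \<in> (\<lambda>k. y k / w k) ` S"
    unfolding r_def using S by (intro Min_in) auto
  then obtain e where e: "e \<in> S" "r = y e / w e" by blast
  have r: "r > 0" using e by (auto simp: S_def zero_less_mult_iff divide_pos_pos divide_neg_neg)
  have conf: "y k * (y k - r * w k) \<ge> 0" for k
  proof (cases "k \<in> S")
    case True
    then have "r \<le> y k / w k" unfolding r_def using S by auto
    with True have "r * (y k * w k) \<le> y k / w k * (y k * w k)"
      by (intro mult_right_mono) (auto simp: S_def)
    also have "\<dots> = y k * y k" using True by (auto simp: S_def)
    finally show ?thesis by (simp only: right_diff_distrib diff_ge_0_iff_ge mult.left_commute[of "y k" r])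
  next
    case False
    with r have "r * (y k * w k) \<le> 0"
      by (simp add: S_def not_less mult_nonneg_nonpos)
    then have "r * (y k * w k) \<le> y k * y k"
      using zero_le_square order_trans by blast
    then show ?thesis by (simp only: right_diff_distrib diff_ge_0_iff_ge mult.left_commute[of "y k" r])
  qed
  have "supp (\<lambda>k. y k - r * w k) \<subseteq> supp y" using sub by (auto simp: supp_def)
  moreover have "e \<in> supp y" "e \<notin> supp (\<lambda>k. y k - r * w k)"
    using e by (auto simp: supp_def S_def)
  ultimately have "supp (\<lambda>k. y k - r * w k) \<subset> supp y" by blast
  with r conf that show ?thesis by blast
qed

text \<open>This is the decomposition of a vector into elementary vectors without cancellation in
  any coordinate, cast as an induction rule. A nonzero \<open>y\<close> that is not elementary
  splits conformally into vectors of smaller support, by moving along some \<open>w\<close> of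
  smaller support.\<close>

lemma conformal_induct [consumes 1, case_names zero elementary scale add]:
  assumes "y \<in> L"
    and zero: "P (\<lambda>_. 0)"
    and elementary: "\<And>y. elementary y \<Longrightarrow> P y"
    and scale: "\<And>y c. y \<in> L \<Longrightarrow> P y \<Longrightarrow> c > 0 \<Longrightarrow> P (\<lambda>k. c * y k)"
    and add: "\<And>y z. y \<in> L \<Longrightarrow> z \<in> L \<Longrightarrow> P y \<Longrightarrow> P z \<Longrightarrow> (\<And>k. y k * z k \<ge> 0) \<Longrightarrow> P (\<lambda>k. y k + z k)"
  shows "P y"
  using assms(1)
proof (induction "card (supp y)" arbitrary: y rule: less_induct)
  case less
  have IH: "P z" if "z \<in> L" "supp z \<subset> supp y" for z
    using less.hyps[OF psubset_card_mono] less.prems finite_supp that by blast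
  have mem: "(\<lambda>k. y k - c * z k) \<in> L" if "z \<in> L" for z c
    using comb_mem[OF less.prems that, of 1 "- c"] by simp
  consider "supp y = {}" | "elementary y" | z where "z \<in> L" "supp z \<noteq> {}" "supp z \<subset> supp y"
    using less.prems by (auto simp: elementary_def)
  then show ?case
  proof cases
    case 1
    then have "y = (\<lambda>_. 0)" by (auto simp: supp_def)
    with zero show ?thesis by simp
  next
    case 3
    \<comment> \<open>Up to its sign, \<open>z\<close> agrees in sign with \<open>y\<close> at some
      coordinate, as the reduction requires.\<close>
    obtain w where w: "w \<in> L" "supp w \<subset> supp y" "\<exists>k. y k * w k > 0"
    proof -
      from 3 obtain k where k: "z k \<noteq> 0" "y k \<noteq> 0" by (auto simp: supp_def)
      show ?thesis
      proof (cases "y k * z k > 0")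
        case True
        with that 3 show ?thesis by blast
      next
        case False
        with k have "y k * (- 1 * z k) > 0"
          by (auto simp: not_less order_less_le)
        moreover have "supp (\<lambda>k. - 1 * z k) = supp z" by (simp add: supp_def)
        ultimately show ?thesis using that[OF scale_mem[of z "-1"]] 3 by metis
      qed
    qed
    obtain r where r: "r > 0"
      "\<And>k. y k * (y k - r * w k) \<ge> 0" "supp (\<lambda>k. y k - r * w k) \<subset> supp y"
      by (rule conformal_reduction[OF less.prems w(1) psubset_imp_subset[OF w(2)] w(3)]) (rule that)
    note P1 = IH[OF mem[OF w(1)] r(3)]
    \<comment> \<open>If \<open>-w\<close> also agrees in sign with \<open>y\<close> somewhere, both
      directions reduce \<open>y\<close>, which lies between the two results; otherwise
      \<open>w\<close> is conformal to \<open>y\<close> and can be split off directly.\<close>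
    show ?thesis
    proof (cases "\<exists>k. y k * (- 1 * w k) > 0")
      case True
      have sub: "supp (\<lambda>k. - 1 * w k) \<subseteq> supp y" using w(2) by (auto simp: supp_def)
      obtain s where s: "s > 0"
        "\<And>k. y k * (y k - s * (- 1 * w k)) \<ge> 0" "supp (\<lambda>k. y k - s * (- 1 * w k)) \<subset> supp y"
        by (rule conformal_reduction[OF less.prems scale_mem[OF w(1)] sub True]) (rule that)
      note P2 = IH[OF mem[OF scale_mem[OF w(1)]] s(3)]
      \<comment> \<open>The weights add up to 1 and cancel the two multiples of
        \<open>w\<close>.\<close>
      let ?u = "\<lambda>k. s / (r + s) * (y k - r * w k)"
      let ?v = "\<lambda>k. r / (r + s) * (y k - s * (- 1 * w k))"
      have "P (\<lambda>k. ?u k + ?v k)"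
      proof (rule add)
        have "s / (r + s) > 0" "r / (r + s) > 0" using r(1) s(1) by simp_all
        from scale[OF mem[OF w(1)] P1 this(1)] scale[OF mem[OF scale_mem[OF w(1)]] P2 this(2)]
        show "P ?u" "P ?v" .
        show "?u \<in> L" "?v \<in> L" by (intro scale_mem mem w(1))+
        fix k
        have "(y k - r * w k) * (y k - s * (- 1 * w k)) \<ge> 0"
        proof (cases "y k = 0")
          case True
          then have "w k = 0" using w(2) by (auto simp: supp_def)
          with True show ?thesis by simp
        next
          case False
          then show ?thesis using r(2) s(2) by (rule mult_nonneg_trans)
        qed
        then show "?u k * ?v k \<ge> 0"
          using mult_nonneg_nonneg[of "s / (r + s) * (r / (r + s))"] r(1) s(1)
          by (simp only: mult_ac) simp
      qed
      moreover have "?u k + ?v k = y k" for k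
      proof -
        have "?u k + ?v k = (s + r) / (r + s) * y k"
          by (simp add: add_divide_distrib[symmetric]) (simp add: algebra_simps)
        also have "\<dots> = y k" using r(1) s(1) by (simp add: add.commute)
        finally show ?thesis .
      qed
      ultimately show ?thesis by simp
    next
      case False
      then have yw: "y k * w k \<ge> 0" for k by (auto simp: not_less)
      have "P (\<lambda>k. (y k - r * w k) + r * w k)"
      proof (rule add)
        show "P (\<lambda>k. r * w k)" using IH[OF w(1,2)] by (intro scale w(1) r(1))
        show "P (\<lambda>k. y k - r * w k)" by fact
        show "(\<lambda>k. y k - r * w k) \<in> L" "(\<lambda>k. r * w k) \<in> L" by (intro scale_mem mem w(1))+
        fix k
        show "(y k - r * w k) * (r * w k) \<ge> 0"
        proof (cases "y k = 0")
          case True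
          then have "w k = 0" using w(2) by (auto simp: supp_def)
          with True show ?thesis by simp
        next
          case False
          moreover have "y k * (r * w k) \<ge> 0"
            using r(1) yw[of k] by (simp add: mult.left_commute[of "y k"])
          ultimately show ?thesis using r(2) mult_nonneg_trans by blast
        qed
      qed
      then show ?thesis by simp
    qed
  qed (rule elementary)
qed

text \<open>For \<open>a \<le> b\<close> this is the support function of the box, attained at an
  endpoint in each coordinate. The index set \<open>S\<close> allows one coordinate to be split
  off.\<close>

definition box_max :: "'e set \<Rightarrow> ('e \<Rightarrow> 'a) \<Rightarrow> ('e \<Rightarrow> 'a) \<Rightarrow> ('e \<Rightarrow> 'a) \<Rightarrow> 'a" where
  "box_max S a b y = (\<Sum>k\<in>S. max (y k * a k) (y k * b k))"

lemma box_max_ge: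
  assumes "\<And>k. k \<in> S \<Longrightarrow> a k \<le> x k \<and> x k \<le> b k"
  shows "(\<Sum>k\<in>S. y k * x k) \<le> box_max S a b y"
  unfolding box_max_def
proof (rule sum_mono)
  fix k assume "k \<in> S"
  with assms[of k] show "y k * x k \<le> max (y k * a k) (y k * b k)"
    by (cases "y k \<ge> 0") (auto simp: le_max_iff_disj mult_left_mono mult_left_mono_neg)
qed

lemma box_max_scale: "c \<ge> 0 \<Longrightarrow> box_max S a b (\<lambda>k. c * y k) = c * box_max S a b y"
  by (simp only: box_max_def sum_distrib_left max_mult_distrib_left mult.assoc if_True)

lemma box_max_subadditive: "box_max S a b (\<lambda>k. y k + z k) \<le> box_max S a b y + box_max S a b z"
  unfolding box_max_def sum.distrib[symmetric]
  by (rule sum_mono) (auto simp: distrib_right intro!: add_mono)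

text \<open>Where \<open>y\<close> and \<open>z\<close> do not have opposite signs, the same
  endpoint is optimal for both.\<close>

lemma box_max_conformal:
  assumes "\<And>k. y k * z k \<ge> 0" "\<And>k. k \<in> S \<Longrightarrow> a k \<le> b k"
  shows "box_max S a b (\<lambda>k. y k + z k) = box_max S a b y + box_max S a b z"
  unfolding box_max_def sum.distrib[symmetric]
proof (rule sum.cong)
  fix k assume "k \<in> S"
  then have ab: "a k \<le> b k" by (rule assms)
  have m: "max (u * a k) (u * b k) = (if u \<ge> 0 then u * b k else u * a k)" for u
    using ab by (auto simp: max_def mult_left_mono mult_left_mono_neg intro!: antisym)
  show "max ((y k + z k) * a k) ((y k + z k) * b k)
      = max (y k * a k) (y k * b k) + max (z k * a k) (z k * b k)"
    using assms(1)[of k] unfolding m zero_le_mult_iff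
    by (auto simp: algebra_simps)
qed simp

text \<open>Additivity on conformal sums carries the condition from elementary vectors to all of
  \<open>L\<close>.\<close>

lemma box_max_nonneg:
  assumes "y \<in> L" "\<And>k. k \<in> E \<Longrightarrow> a k \<le> b k" "\<And>z. elementary z \<Longrightarrow> box_max E a b z \<ge> 0"
  shows "box_max E a b y \<ge> 0"
  using assms(1)
proof (induction rule: conformal_induct)
  case zero
  show ?case by (simp add: box_max_def)
next
  case (elementary y)
  then show ?case by (rule assms(3))
next
  case (scale y c)
  then show ?case by (simp add: box_max_scale)
next
  case (add y z)
  show ?case
    by (subst box_max_conformal[OF add.hyps(3) assms(2)]) (use add.IH in auto)
qed

text \<open>An elementary vector is determined by its support and its value at \<open>e\<close>.
  Finiteness lets a maximum replace a supremum, which may fail to exist in an ordered field.\<close>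

lemma finite_normalized_elementary: "finite {y. elementary y \<and> y e = 1}"
proof (rule finite_imageD)
  have "supp ` {y. elementary y \<and> y e = 1} \<subseteq> Pow E"
    using supp_subset by (auto simp: elementary_def)
  then show "finite (supp ` {y. elementary y \<and> y e = 1})"
    using finite_E finite_subset by blast
  show "inj_on supp {y. elementary y \<and> y e = 1}"
  proof (rule inj_onI)
    fix y z
    assume yz: "y \<in> {y. elementary y \<and> y e = 1}" "z \<in> {y. elementary y \<and> y e = 1}" "supp y = supp z"
    then obtain c where c: "z = (\<lambda>k. c * y k)" using elementary_unique[of y z] by blast
    with yz have "c = 1" by auto
    with c show "y = z" by simp
  qed
qed

text \<open>
  The intervals are shrunk to points one coordinate at a time.  The bounds on the new value come from the
  finitely many normalized elementary vectors, so it suffices to compare a lower bound from \<open>y\<close> with an upper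
  bound from \<open>z\<close>; this is the case of \<open>y - z\<close>, which vanishes at the chosen coordinate.
\<close>

theorem rockafellar:
  assumes "\<And>k. k \<in> E \<Longrightarrow> a k \<le> b k" "\<And>y. elementary y \<Longrightarrow> box_max E a b y \<ge> 0"
  obtains x where "\<And>k. k \<in> E \<Longrightarrow> a k \<le> x k \<and> x k \<le> b k" "\<And>y. y \<in> L \<Longrightarrow> (\<Sum>k\<in>E. y k * x k) = 0"
proof -
  have "\<exists>x. (\<forall>k\<in>E. a k \<le> x k \<and> x k \<le> b k) \<and> (\<forall>y\<in>L. (\<Sum>k\<in>E. y k * x k) = 0)"
    using assms
  proof (induction "card {k \<in> E. a k \<noteq> b k}" arbitrary: a b rule: less_induct)
    case less
    note ab = less.prems(1)
    note nonneg = box_max_nonneg[of _ a b, OF _ less.prems]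
    show ?case
    proof (cases "\<exists>e\<in>E. a e \<noteq> b e")
      case False
      \<comment> \<open>All intervals are points here, and nonnegativity for both \<open>y\<close>
        and \<open>-y\<close> forces the form to vanish.\<close>
      then have eq: "box_max E a b y = (\<Sum>k\<in>E. y k * a k)" for y
        using False unfolding box_max_def by (intro sum.cong) auto
      have "(\<Sum>k\<in>E. y k * a k) = 0" if y: "y \<in> L" for y
        using nonneg[OF y] nonneg[OF scale_mem[OF y, of "-1"]]
        unfolding eq by (simp add: sum_negf)
      with False show ?thesis by (intro exI[of _ a]) auto
    next
      case True
      then obtain e where e: "e \<in> E" "a e \<noteq> b e" by blast
      let ?f = "box_max (E - {e}) a b"
      let ?N = "{y. elementary y \<and> y e = 1}"
      have split: "box_max E a' b' y = max (y e * a' e) (y e * b' e) + box_max (E - {e}) a' b' y" for a' b' y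
        unfolding box_max_def using e finite_E by (simp add: sum.remove)
      \<comment> \<open>The largest lower bound imposed on coordinate \<open>e\<close>; the entry
        \<open>a e\<close> keeps \<open>c\<close> in the interval and the set nonempty.\<close>
      define c where "c = Max (insert (a e) ((\<lambda>y. - ?f y) ` ?N))"
      have fin: "finite (insert (a e) ((\<lambda>y. - ?f y) ` ?N))"
        using finite_normalized_elementary by simp
      have lower: "a e \<le> c" "- ?f y \<le> c" if "y \<in> ?N" for y
        unfolding c_def using that by (auto intro!: Max_ge fin simp del: Max_insert)
      have ac: "a e \<le> c"
        unfolding c_def by (auto intro!: Max_ge fin)
      have cb: "c \<le> b e"
      proof -
        have "- ?f y \<le> b e" if "y \<in> ?N" for y
          using less.prems(2)[of y] split[of a b y] ab[OF e(1)] that by simp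
        then show ?thesis unfolding c_def using fin ab[OF e(1)] by (subst Max_le_iff) auto
      qed
      have upper: "c \<le> ?f (\<lambda>k. - 1 * z k)" if z: "z \<in> ?N" for z
      proof -
        have zL: "z \<in> L" using z by (simp add: elementary_def)
        have "a e \<le> ?f (\<lambda>k. - 1 * z k)"
          using nonneg[OF scale_mem[OF zL, of "-1"]] split[of a b "\<lambda>k. - 1 * z k"] ab[OF e(1)] z by simp
        moreover have "- ?f y \<le> ?f (\<lambda>k. - 1 * z k)" if y: "y \<in> ?N" for y
        proof -
          have "y \<in> L" using y by (simp add: elementary_def)
          from nonneg[OF add_mem[OF this scale_mem[OF zL, of "-1"]]]
          have "0 \<le> ?f (\<lambda>k. y k + - 1 * z k)"
            using y z by (simp add: split)
          also have "\<dots> \<le> ?f y + ?f (\<lambda>k. - 1 * z k)" by (rule box_max_subadditive)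
          finally show ?thesis by simp
        qed
        ultimately show ?thesis unfolding c_def using fin by (subst Max_le_iff) auto
      qed
      let ?a = "a(e := c)" and ?b = "b(e := c)"
      have f': "box_max (E - {e}) ?a ?b y = ?f y" for y
        unfolding box_max_def by (intro sum.cong) auto
      have "\<exists>x. (\<forall>k\<in>E. ?a k \<le> x k \<and> x k \<le> ?b k) \<and> (\<forall>y\<in>L. (\<Sum>k\<in>E. y k * x k) = 0)"
      proof (rule less.hyps)
        have "{k \<in> E. ?a k \<noteq> ?b k} \<subset> {k \<in> E. a k \<noteq> b k}" using e by auto
        then show "card {k \<in> E. ?a k \<noteq> ?b k} < card {k \<in> E. a k \<noteq> b k}"
          by (intro psubset_card_mono) (auto simp: finite_E)
        show "?a k \<le> ?b k" if "k \<in> E" for k using ab[OF that] by simp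
        fix y assume y: "elementary y"
        show "box_max E ?a ?b y \<ge> 0"
        proof (cases "y e = 0")
          case True
          then show ?thesis using less.prems(2)[OF y] by (simp add: split f')
        next
          case False
          \<comment> \<open>After normalization at \<open>e\<close>, the sign of \<open>y e\<close>
            decides whether the lower or the upper bounds on \<open>c\<close> apply.\<close>
          define z where "z = (\<lambda>k. inverse (y e) * y k)"
          have z: "z \<in> ?N" using elementary_scale[OF y, of "inverse (y e)"] False by (simp add: z_def)
          have yz: "y = (\<lambda>k. y e * z k)" "y = (\<lambda>k. (- y e) * (- 1 * z k))"
            using False by (simp_all add: z_def fun_eq_iff mult.assoc[symmetric])
          show ?thesis
          proof (cases "y e > 0")
            case True
            have "box_max E ?a ?b z \<ge> 0" using lower(2)[OF z] z by (simp add: split f')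
            with True have "y e * box_max E ?a ?b z \<ge> 0" by simp
            also have "y e * box_max E ?a ?b z = box_max E ?a ?b y"
              using box_max_scale[of "y e" E ?a ?b z] True by (simp flip: yz(1))
            finally show ?thesis .
          next
            case neg: False
            have "box_max E ?a ?b (\<lambda>k. - 1 * z k) \<ge> 0" using upper[OF z] z by (simp add: split f')
            with neg have "(- y e) * box_max E ?a ?b (\<lambda>k. - 1 * z k) \<ge> 0"
              by (intro mult_nonneg_nonneg) auto
            also have "(- y e) * box_max E ?a ?b (\<lambda>k. - 1 * z k) = box_max E ?a ?b y"
              using box_max_scale[of "- y e" E ?a ?b "\<lambda>k. - 1 * z k"] neg by (simp only: flip: yz(2))
            finally show ?thesis .
          qed
        qed
      qed
      then obtain x where x: "\<And>k. k \<in> E \<Longrightarrow> ?a k \<le> x k \<and> x k \<le> ?b k" "\<forall>y\<in>L. (\<Sum>k\<in>E. y k * x k) = 0"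
        by blast
      have "a k \<le> x k \<and> x k \<le> b k" if "k \<in> E" for k
        using x(1)[OF that] ac cb by (cases "k = e") auto
      with x(2) show ?thesis by blast
    qed
  qed
  with that show ?thesis by blast
qed

end



section \<open>Valuations and signs of Puiseux series\<close>

text \<open>The rationals are not well-ordered; a least exponent exists because the exponents have a
  common denominator and a lower bound, which the passage to a Laurent series exploits.\<close>

lemma val_le:
  assumes "pcoeff x q \<noteq> 0"
  shows "val x \<le> q"
proof -
  obtain m f where m: "m > 0" and x: "x = puiseux_of_fls m f"
    by (rule puiseux_of_fls_cases3)
  from assms obtain n where n: "of_nat m * q = of_int n" "fls_nth f \<lfloor>of_nat m * q\<rfloor> \<noteq> 0"
    by (auto simp: x puiseux_of_fls.rep_eq split: if_splits elim: Ints_cases)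
  then have "f \<noteq> 0" by auto
  with n fls_subdegree_leI[OF n(2)] m show ?thesis
    by (simp add: x val_puiseux_of_fls field_simps)
qed

lemma pcoeff_below_val: "q < val x \<Longrightarrow> pcoeff x q = 0"
  using val_le[of x q] by fastforce

lemma val_eqI:
  assumes "pcoeff x v \<noteq> 0" "\<And>q. q < v \<Longrightarrow> pcoeff x q = 0"
  shows "val x = v"
proof -
  from assms(1) have "x \<noteq> 0" by (auto simp: zero_puiseux.rep_eq)
  then have "lead x \<noteq> 0" by simp
  with assms(2) have "\<not> val x < v" by (metis (no_types))
  with val_le[OF assms(1)] show ?thesis by simp
qed

lemma val_1 [simp]: "val 1 = 0"
  by (rule val_eqI) (simp_all add: one_puiseux.rep_eq)

lemma val_uminus [simp]: "val (- x) = val x"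
  by (simp add: val_def uminus_puiseux.rep_eq)

lemma val_mult:
  assumes "x \<noteq> 0" "y \<noteq> 0"
  shows "val (x * y) = val x + val y"
proof -
  obtain m f g where m: "m > 0" and *: "x = puiseux_of_fls m f" "y = puiseux_of_fls m g"
    by (rule puiseux_of_fls_cases3)
  with assms have "f \<noteq> 0" "g \<noteq> 0" by (auto simp: puiseux_of_fls_0)
  with m show ?thesis
    by (simp add: * puiseux_of_fls_mult val_puiseux_of_fls add_divide_distrib)
qed

lemma val_power: "x \<noteq> 0 \<Longrightarrow> val (x ^ n) = of_nat n * val x"
  by (induction n) (simp_all add: val_mult algebra_simps)

lemma val_prod:
  "(\<And>i. i \<in> S \<Longrightarrow> f i \<noteq> 0) \<Longrightarrow> val (\<Prod>i\<in>S. f i) = (\<Sum>i\<in>S. val (f i))"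
  by (induction S rule: infinite_finite_induct) (simp_all add: val_mult)

lemma pcoeff_sum: "pcoeff (\<Sum>i\<in>S. f i) q = (\<Sum>i\<in>S. pcoeff (f i) q)"
  by (induction S rule: infinite_finite_induct) (simp_all add: plus_puiseux.rep_eq zero_puiseux.rep_eq)

lemma puiseux_pos_iff: "0 < x \<longleftrightarrow> 0 < lead x"
  by (simp add: less_puiseux_def)

text \<open>Otherwise \<open>y - x\<close> would have the leading term of \<open>-x\<close> and be
  negative.\<close>

lemma val_antimono:
  assumes "0 < x" "x \<le> y"
  shows "val y \<le> val x"
proof (rule ccontr)
  assume "\<not> val y \<le> val x"
  then have less: "val x < val y" by simp
  have pos: "lead x > 0" using assms(1) by (simp add: puiseux_pos_iff)
  have d: "pcoeff (y - x) (val x) = - lead x"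
    using less by (simp add: minus_puiseux.rep_eq pcoeff_below_val)
  have "val (y - x) = val x"
    using less pos d by (intro val_eqI) (simp_all add: minus_puiseux.rep_eq pcoeff_below_val del: lead_eq_0_iff)
  with d pos have "lead (y - x) < 0" by simp
  with assms(2) show False
    by (auto simp: less_eq_puiseux_def less_puiseux_def zero_puiseux.rep_eq)
qed

lemma less_if_val_less: "0 < x \<Longrightarrow> 0 < y \<Longrightarrow> val y < val x \<Longrightarrow> x < y"
  using val_antimono[of y x] by force

text \<open>Up to the exponent \<open>val (f i)\<close> the sum has the coefficients of
  \<open>f i\<close>, hence the same leading term. Zero terms are exempt from the bound because
  \<open>val 0\<close> is unspecified.\<close>

lemma sum_dominated_pos:
  assumes "finite S" "i \<in> S" "0 < f i"
    and dom: "\<And>k. k \<in> S \<Longrightarrow> k \<noteq> i \<Longrightarrow> f k \<noteq> 0 \<Longrightarrow> val (f i) < val (f k)"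
  shows "0 < (\<Sum>k\<in>S. f k)"
proof -
  have rest: "pcoeff (f k) q = 0" if "k \<in> S - {i}" "q \<le> val (f i)" for k q
    using that dom[of k] by (cases "f k = 0") (auto simp: zero_puiseux.rep_eq pcoeff_below_val)
  have sum: "pcoeff (\<Sum>k\<in>S. f k) q = pcoeff (f i) q" if "q \<le> val (f i)" for q
    using rest that by (simp add: pcoeff_sum sum.remove[OF assms(1,2), of "\<lambda>k. pcoeff (f k) q"])
  have pos: "lead (f i) > 0" using assms(3) by (simp add: puiseux_pos_iff)
  have "val (\<Sum>k\<in>S. f k) = val (f i)"
    using pos by (intro val_eqI) (simp_all add: sum pcoeff_below_val del: lead_eq_0_iff)
  then show ?thesis using pos by (simp add: puiseux_pos_iff sum)
qed

text \<open>At the least exponent the coefficients add up to 0 without all being 0, so one of them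
  is positive.\<close>

lemma sum_zero_min_term_pos:
  assumes "finite S" "S \<noteq> {}" "\<And>k. k \<in> S \<Longrightarrow> f k \<noteq> 0" "(\<Sum>k\<in>S. f k) = 0"
  obtains i where "i \<in> S" "0 < f i" "\<And>k. k \<in> S \<Longrightarrow> val (f i) \<le> val (f k)"
proof -
  define m where "m = Min ((\<lambda>k. val (f k)) ` S)"
  have le: "m \<le> val (f k)" if "k \<in> S" for k
    unfolding m_def using assms(1) that by simp
  have "m \<in> (\<lambda>k. val (f k)) ` S" unfolding m_def using assms(1,2) by (intro Min_in) auto
  then obtain j where j: "j \<in> S" "val (f j) = m" by blast
  have "(\<Sum>k\<in>S. pcoeff (f k) m) = 0"
    using assms(4) pcoeff_sum[of f S m] by (simp add: zero_puiseux.rep_eq)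
  moreover have "pcoeff (f j) m \<noteq> 0" using j assms(3) by auto
  ultimately have "\<not> (\<forall>k\<in>S. pcoeff (f k) m \<le> 0)"
    using sum_nonneg_eq_0_iff[of S "\<lambda>k. - pcoeff (f k) m"] assms(1) j(1) by (auto simp: sum_negf)
  then obtain i where i: "i \<in> S" "pcoeff (f i) m > 0"
    by (auto simp: not_le)
  then have "val (f i) = m" using le[OF i(1)] val_le[of "f i" m] by force
  with i le that show ?thesis by (simp add: puiseux_pos_iff)
qed

section \<open>Powers of t and signs of products\<close>

lift_definition tpow :: "rat \<Rightarrow> puiseux" is "\<lambda>r q. if q = r then 1 else 0"
proof -
  fix r :: rat
  obtain a b where r: "r = Fract a b" "b > 0" by (rule Rat_cases)
  then have "of_nat (nat b) * r = of_int a" by (simp add: Fract_of_int_quotient)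
  with r show "\<exists>m::nat. m > 0 \<and> (\<exists>N. \<forall>q. (if q = r then 1 else 0 :: real) \<noteq> 0 \<longrightarrow> of_nat m * q \<in> \<int> \<and> N \<le> q)"
    by (intro exI[of _ "nat b"]) (auto simp del: of_nat_nat)
qed

lemma val_tpow [simp]: "val (tpow r) = r"
  by (rule val_eqI) (simp_all add: tpow.rep_eq)

lemma tpow_pos [simp]: "0 < tpow r"
  by (simp add: puiseux_pos_iff tpow.rep_eq)

lemma tpow_nonzero [simp]: "tpow r \<noteq> 0"
  using tpow_pos[of r] by (metis order_less_irrefl)

lemma psign_mult: "x \<noteq> 0 \<Longrightarrow> y \<noteq> 0 \<Longrightarrow> psign (x * y) = psign x * psign y"
  by (auto simp: psign_def zero_less_mult_iff not_less)

lemma psign_1 [simp]: "psign 1 = 1"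
  by (simp add: psign_def)

lemma psign_power: "x \<noteq> 0 \<Longrightarrow> psign (x ^ n) = psign x ^ n"
  by (induction n) (simp_all add: psign_mult)

lemma psign_prod:
  "(\<And>i. i \<in> S \<Longrightarrow> f i \<noteq> 0) \<Longrightarrow> psign (\<Prod>i\<in>S. f i) = (\<Prod>i\<in>S. psign (f i))"
  by (induction S rule: infinite_finite_induct) (simp_all add: psign_mult)

text \<open>As a function of the exponent this is the vector of monomial values at \<open>z\<close>;
  evaluation of a polynomial pairs it with the coefficient vector.\<close>

definition monomial_eval :: "puiseux ^ 'n::finite \<Rightarrow> 'n exponent \<Rightarrow> puiseux" where
  "monomial_eval z l = (\<Prod>k\<in>UNIV. z $ k ^ (l $ k))"

context
  fixes z :: "puiseux ^ 'n::finite"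
  assumes nonzero: "\<And>k. z $ k \<noteq> 0"
begin

lemma monomial_eval_nonzero: "monomial_eval z l \<noteq> 0"
  using nonzero by (simp add: monomial_eval_def)

lemma val_monomial_eval: "val (monomial_eval z l) = (\<Sum>k\<in>UNIV. of_nat (l $ k) * val (z $ k))"
  using nonzero by (simp add: monomial_eval_def val_prod val_power)

lemma psign_monomial_eval: "psign (monomial_eval z l) = (\<Prod>k\<in>UNIV. psign (z $ k) ^ (l $ k))"
  using nonzero by (simp add: monomial_eval_def psign_prod psign_power)

lemma term_val_trop:
  assumes "l \<in> Poly_Mapping.keys F"
  shows "term_val F (trop z) l = of_rat (val (Poly_Mapping.lookup F l * monomial_eval z l))"
  using assms by (simp add: in_keys_iff term_val_def trop_def val_mult monomial_eval_nonzero
      val_monomial_eval of_rat_add of_rat_sum of_rat_mult)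

lemma term_sign_trop:
  assumes "l \<in> Poly_Mapping.keys F"
  shows "term_sign F (trop z) l = psign (Poly_Mapping.lookup F l * monomial_eval z l)"
  using assms by (simp add: in_keys_iff term_sign_def trop_def psign_mult monomial_eval_nonzero
      psign_monomial_eval)

end


section \<open>Real tropical hypersurfaces\<close>

text \<open>Minimality stated by inequalities makes it visible that the conditions are
  closed.\<close>

lemma trop_hypersurface_iff:
  "p \<in> trop_hypersurface F \<longleftrightarrow> p \<in> TR \<and> (\<exists>i\<in>Poly_Mapping.keys F. \<exists>j\<in>Poly_Mapping.keys F.
     (\<forall>l\<in>Poly_Mapping.keys F. term_val F p i \<le> term_val F p l \<and> term_val F p j \<le> term_val F p l) \<and>
     term_sign F p i = 1 \<and> term_sign F p j = - 1)"
proof -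
  have "term_val F p i = Min (term_val F p ` Poly_Mapping.keys F) \<longleftrightarrow>
      (\<forall>l\<in>Poly_Mapping.keys F. term_val F p i \<le> term_val F p l)" if "i \<in> Poly_Mapping.keys F" for i
  proof -
    have "Min (term_val F p ` Poly_Mapping.keys F) \<le> term_val F p i"
      using that by simp
    moreover have "term_val F p i \<le> Min (term_val F p ` Poly_Mapping.keys F) \<longleftrightarrow>
      (\<forall>l\<in>Poly_Mapping.keys F. term_val F p i \<le> term_val F p l)"
      using that by (subst Min_ge_iff) auto
    ultimately show ?thesis by force
  qed
  then show ?thesis
    unfolding trop_hypersurface_def by (auto; metis one_neq_neg_one)
qed

text \<open>A vanishing sum has minimal terms of both signs; the negative one is found among the
  negated terms.\<close>

lemma trop_in_hypersurface:
  assumes "F \<noteq> 0" "mpoly_eval F z = 0" and nonzero: "\<And>k. z $ k \<noteq> 0"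
  shows "trop z \<in> trop_hypersurface F"
proof -
  let ?K = "Poly_Mapping.keys F" and ?f = "\<lambda>l. Poly_Mapping.lookup F l * monomial_eval z l"
  have f: "?f l \<noteq> 0" if "l \<in> ?K" for l
    using that by (simp add: in_keys_iff monomial_eval_nonzero nonzero)
  have sum: "(\<Sum>l\<in>?K. ?f l) = 0"
    using assms(2) by (simp add: mpoly_eval_def monomial_eval_def)
  have sum': "(\<Sum>l\<in>?K. - ?f l) = 0" using sum by (simp add: sum_negf)
  have f': "- ?f l \<noteq> 0" if "l \<in> ?K" for l using f[OF that] by simp
  have ne: "?K \<noteq> {}" using assms(1) by simp
  obtain i where i: "i \<in> ?K" "0 < ?f i" "\<And>l. l \<in> ?K \<Longrightarrow> val (?f i) \<le> val (?f l)"
    by (rule sum_zero_min_term_pos[OF finite_keys ne _ sum]) (rule f, assumption, rule that)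
  obtain j where j: "j \<in> ?K" "0 < - ?f j" "\<And>l. l \<in> ?K \<Longrightarrow> val (- ?f j) \<le> val (- ?f l)"
    by (rule sum_zero_min_term_pos[OF finite_keys ne _ sum']) (rule f', assumption, rule that)
  have "trop z \<in> TR" by (simp add: TR_def trop_def psign_def)
  then show ?thesis
    unfolding trop_hypersurface_iff using i j
    by (intro conjI bexI[of _ i] bexI[of _ j])
       (auto simp: term_val_trop term_sign_trop nonzero of_rat_less_eq psign_def)
qed

text \<open>Valuation and sign of a term depend continuously on \<open>p\<close>, and the exponents
  range over a finite set, so this is a finite union of closed sets cut with
  \<open>TR\<close>.\<close>

lemma closed_trop_hypersurface: "closedin (top_of_set TR) (trop_hypersurface F)"
proof -
  let ?K = "Poly_Mapping.keys F"
  have cont_val: "continuous_on UNIV (\<lambda>p. term_val F p i)" for i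
    unfolding term_val_def by (intro continuous_intros)
  have cont_sign: "continuous_on UNIV (\<lambda>p. term_sign F p i)" for i
    unfolding term_sign_def by (intro continuous_intros)
  have "trop_hypersurface F = TR \<inter> (\<Union>i\<in>?K. \<Union>j\<in>?K.
      (\<Inter>l\<in>?K. {p. term_val F p i \<le> term_val F p l} \<inter> {p. term_val F p j \<le> term_val F p l}) \<inter>
      ({p. term_sign F p i = 1} \<inter> {p. term_sign F p j = - 1}))"
    by (simp add: set_eq_iff trop_hypersurface_iff)
  also have "closedin (top_of_set TR) \<dots>"
    by (intro closedin_closed_Int closed_UN closed_Int closed_INT ballI finite_keys
        closed_Collect_le closed_Collect_eq cont_val cont_sign continuous_on_const)
  finally show ?thesis .
qed


section \<open>Evaluation of polynomials and multiples by constants\<close>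

lemma lookup_const_mult: "Poly_Mapping.lookup (Poly_Mapping.single 0 c * F) l = c * Poly_Mapping.lookup F l"
  for F :: "'n::finite mpoly"
proof -
  have "Poly_Mapping.single 0 c * F = Poly_Mapping.map ((*) c) F"
    by (rule mult_map_scale_conv_mult[symmetric])
  then show ?thesis by (simp add: Poly_Mapping.map.rep_eq when_def)
qed

lemma keys_const_mult: "c \<noteq> 0 \<Longrightarrow> Poly_Mapping.keys (Poly_Mapping.single 0 c * F) = Poly_Mapping.keys F"
  for F :: "'n::finite mpoly"
  by (auto simp: in_keys_iff lookup_const_mult)

lemma mpoly_eval_superset:
  assumes "finite S" "Poly_Mapping.keys F \<subseteq> S"
  shows "mpoly_eval F z = (\<Sum>l\<in>S. Poly_Mapping.lookup F l * monomial_eval z l)"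
  unfolding mpoly_eval_def monomial_eval_def
  using assms by (intro sum.mono_neutral_left) (auto simp: in_keys_iff)

lemma mpoly_eval_0 [simp]: "mpoly_eval 0 z = 0"
  by (simp add: mpoly_eval_def)

lemma mpoly_eval_add: "mpoly_eval (F + G) z = mpoly_eval F z + mpoly_eval G z"
proof -
  let ?S = "Poly_Mapping.keys F \<union> Poly_Mapping.keys G"
  have "Poly_Mapping.keys (F + G) \<subseteq> ?S" by (rule keys_add)
  then show ?thesis
    by (simp add: mpoly_eval_superset[of ?S] lookup_add distrib_right sum.distrib)
qed

lemma mpoly_eval_sum: "mpoly_eval (\<Sum>i\<in>S. f i) z = (\<Sum>i\<in>S. mpoly_eval (f i) z)"
  by (induction S rule: infinite_finite_induct) (simp_all add: mpoly_eval_add)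

lemma mpoly_eval_single: "mpoly_eval (Poly_Mapping.single l c) z = c * monomial_eval z l"
  by (simp add: mpoly_eval_superset[of "{l}"])

lemma monomial_eval_add: "monomial_eval z (l + m) = monomial_eval z l * monomial_eval z m"
  by (simp add: monomial_eval_def power_add prod.distrib)

lemma poly_mapping_sum_single:
  "(\<Sum>l\<in>Poly_Mapping.keys F. Poly_Mapping.single l (Poly_Mapping.lookup F l)) = F"
  by (rule poly_mapping_eqI) (auto simp: lookup_sum lookup_single when_def in_keys_iff)

lemma mpoly_eval_mult: "mpoly_eval (F * G) z = mpoly_eval F z * mpoly_eval G z"
proof -
  let ?s = "\<lambda>F l. Poly_Mapping.single l (Poly_Mapping.lookup F l)"
  have "F * G = (\<Sum>l\<in>Poly_Mapping.keys F. ?s F l) * (\<Sum>m\<in>Poly_Mapping.keys G. ?s G m)"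
    by (simp only: poly_mapping_sum_single)
  also have "\<dots> = (\<Sum>l\<in>Poly_Mapping.keys F. \<Sum>m\<in>Poly_Mapping.keys G.
      Poly_Mapping.single (l + m) (Poly_Mapping.lookup F l * Poly_Mapping.lookup G m))"
    by (simp only: sum_product mult_single)
  finally have "mpoly_eval (F * G) z = (\<Sum>l\<in>Poly_Mapping.keys F. \<Sum>m\<in>Poly_Mapping.keys G.
      (Poly_Mapping.lookup F l * monomial_eval z l) * (Poly_Mapping.lookup G m * monomial_eval z m))"
    by (simp add: mpoly_eval_sum mpoly_eval_single monomial_eval_add mult_ac)
  also have "\<dots> = mpoly_eval F z * mpoly_eval G z"
    by (simp only: sum_product mpoly_eval_def monomial_eval_def)
  finally show ?thesis .
qed

text \<open>The polynomials vanishing at a fixed point form an ideal.\<close>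

lemma zeros_span: "zeros (ideal.span S) = zeros S"
proof
  show "zeros (ideal.span S) \<subseteq> zeros S"
    by (auto simp: zeros_def ideal.span_base)
  show "zeros S \<subseteq> zeros (ideal.span S)"
  proof
    fix z assume z: "z \<in> zeros S"
    have "ideal.span S \<subseteq> {F. mpoly_eval F z = 0}"
      using z by (intro ideal.span_minimal ideal.subspaceI)
        (auto simp: zeros_def mpoly_eval_add mpoly_eval_mult)
    then show "z \<in> zeros (ideal.span S)" by (auto simp: zeros_def)
  qed
qed

text \<open>All valuations shift by \<open>val c\<close> and all signs are multiplied by
  \<open>psign c\<close>; for negative \<open>c\<close> the two minimal terms exchange
  roles.\<close>

lemma trop_hypersurface_const_mult:
  assumes "c \<noteq> 0" "p \<in> trop_hypersurface F"
  shows "p \<in> trop_hypersurface (Poly_Mapping.single 0 c * F)"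
proof -
  let ?K = "Poly_Mapping.keys F" and ?G = "Poly_Mapping.single 0 c * F"
  from assms(2) obtain i j where ij: "p \<in> TR" "i \<in> ?K" "j \<in> ?K"
    "\<And>l. l \<in> ?K \<Longrightarrow> term_val F p i \<le> term_val F p l \<and> term_val F p j \<le> term_val F p l"
    "term_sign F p i = 1" "term_sign F p j = - 1"
    by (auto simp: trop_hypersurface_iff)
  have v: "term_val ?G p l = of_rat (val c) + term_val F p l" if "l \<in> ?K" for l
    using that assms(1) by (simp add: term_val_def lookup_const_mult val_mult of_rat_add in_keys_iff)
  have s: "term_sign ?G p l = psign c * term_sign F p l" if "l \<in> ?K" for l
    using that assms(1) by (simp add: term_sign_def lookup_const_mult psign_mult in_keys_iff)
  have "psign c = 1 \<or> psign c = - 1" by (simp add: psign_def)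
  then show ?thesis
    unfolding trop_hypersurface_iff keys_const_mult[OF assms(1)]
  proof
    assume "psign c = 1"
    then show "p \<in> TR \<and> (\<exists>i\<in>?K. \<exists>j\<in>?K.
     (\<forall>l\<in>?K. term_val ?G p i \<le> term_val ?G p l \<and> term_val ?G p j \<le> term_val ?G p l) \<and>
     term_sign ?G p i = 1 \<and> term_sign ?G p j = - 1)"
      using ij by (intro conjI bexI[of _ i] bexI[of _ j]) (simp_all add: v s)
  next
    assume "psign c = - 1"
    then show "p \<in> TR \<and> (\<exists>i\<in>?K. \<exists>j\<in>?K.
     (\<forall>l\<in>?K. term_val ?G p i \<le> term_val ?G p l \<and> term_val ?G p j \<le> term_val ?G p l) \<and>
     term_sign ?G p i = 1 \<and> term_sign ?G p j = - 1)"
      using ij by (intro conjI bexI[of _ j] bexI[of _ i]) (simp_all add: v s)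
  qed
qed


section \<open>Affine polynomials of an ideal\<close>

definition affine_exponents :: "'n::finite exponent set" where
  "affine_exponents = {l. (\<Sum>k\<in>UNIV. l $ k) \<le> 1}"

lemma affine_exponents_eq: "affine_exponents = insert (0 :: 'n::finite exponent) (range (\<lambda>k. axis k 1))"
proof (intro equalityI subsetI)
  fix l :: "'n exponent" assume l: "l \<in> affine_exponents"
  show "l \<in> insert 0 (range (\<lambda>k. axis k 1))"
  proof (cases "l = 0")
    case False
    then obtain k where k: "l $ k \<noteq> 0" by (auto simp: vec_eq_iff)
    have "l $ k + (\<Sum>j\<in>UNIV - {k}. l $ j) \<le> 1"
      using l by (simp add: affine_exponents_def flip: sum.remove)
    with k have "l $ k = 1" "(\<Sum>j\<in>UNIV - {k}. l $ j) = 0" by linarith+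
    then have "l = axis k 1" by (auto simp: vec_eq_iff axis_def)
    then show ?thesis by simp
  qed simp
next
  fix l :: "'n exponent" assume "l \<in> insert 0 (range (\<lambda>k. axis k 1))"
  then show "l \<in> affine_exponents"
    by (auto simp: affine_exponents_def axis_def)
qed

lemma finite_affine_exponents: "finite (affine_exponents :: 'n::finite exponent set)"
  by (simp add: affine_exponents_eq)

lemma total_degree_le_1_iff:
  "total_degree F \<le> 1 \<longleftrightarrow> Poly_Mapping.keys F \<subseteq> affine_exponents" for F :: "'n::finite mpoly"
  unfolding total_degree_def affine_exponents_def by (subst Max_le_iff) auto

lemma monomial_eval_0 [simp]: "monomial_eval z 0 = 1"
  by (simp add: monomial_eval_def)

lemma monomial_eval_axis [simp]: "monomial_eval z (axis k 1) = z $ k"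
proof -
  have "monomial_eval z (axis k 1) = (\<Prod>j\<in>UNIV. if j = k then z $ j else 1)"
    unfolding monomial_eval_def by (rule prod.cong) (auto simp: axis_def)
  then show ?thesis by simp
qed

text \<open>The degree bound in place of \<open>affine_poly\<close> admits the zero polynomial, as a
  linear space requires.\<close>

definition affine_coeffs :: "'n::finite mpoly set \<Rightarrow> ('n exponent \<Rightarrow> puiseux) set" where
  "affine_coeffs I = Poly_Mapping.lookup ` {F \<in> I. total_degree F \<le> 1}"

lemma supp_lookup: "supp (Poly_Mapping.lookup F) = Poly_Mapping.keys F"
  by (auto simp: supp_def in_keys_iff)

section \<open>Affine polynomials of an ideal as a linear space\<close>

context
  fixes I :: "'n::finite mpoly set"
  assumes I: "ideal.subspace I"
begin

lemma vector_subspace_affine_coeffs: "vector_subspace affine_exponents (affine_coeffs I)"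
proof
  show "finite (affine_exponents :: 'n exponent set)" by (rule finite_affine_exponents)
  show "supp y \<subseteq> affine_exponents" if "y \<in> affine_coeffs I" for y
    using that by (auto simp: affine_coeffs_def total_degree_le_1_iff supp_lookup)
  show "(\<lambda>_. 0) \<in> affine_coeffs I"
    unfolding affine_coeffs_def
    by (intro image_eqI[of _ _ 0]) (auto simp: ideal.subspace_0[OF I] total_degree_le_1_iff)
  show "(\<lambda>k. y k + z k) \<in> affine_coeffs I" if yz: "y \<in> affine_coeffs I" "z \<in> affine_coeffs I" for y z
  proof -
    from yz obtain F G where FG: "y = Poly_Mapping.lookup F" "z = Poly_Mapping.lookup G" "F \<in> I" "G \<in> I"
      "total_degree F \<le> 1" "total_degree G \<le> 1"
      by (auto simp: affine_coeffs_def)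
    with keys_add[of F G] show ?thesis
      unfolding affine_coeffs_def
      by (intro image_eqI[of _ _ "F + G"])
         (auto simp: lookup_add ideal.subspace_add[OF I] total_degree_le_1_iff)
  qed
  show "(\<lambda>k. c * y k) \<in> affine_coeffs I" if y: "y \<in> affine_coeffs I" for y c
  proof -
    from y obtain F where F: "y = Poly_Mapping.lookup F" "F \<in> I" "total_degree F \<le> 1"
      by (auto simp: affine_coeffs_def)
    then show ?thesis
      unfolding affine_coeffs_def
      by (intro image_eqI[of _ _ "Poly_Mapping.single 0 c * F"])
         (auto simp: lookup_const_mult ideal.subspace_scale[OF I] total_degree_le_1_iff in_keys_iff)
  qed
qed

interpretation coeffs: vector_subspace affine_exponents "affine_coeffs I"
  by (rule vector_subspace_affine_coeffs)

lemma elementary_iff_minimal_support: "coeffs.elementary (Poly_Mapping.lookup F) \<longleftrightarrow> minimal_support I F"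
  unfolding coeffs.elementary_def minimal_support_def affine_poly_def
  by (auto simp: affine_coeffs_def supp_lookup)

lemma elementaryE:
  assumes "coeffs.elementary y"
  obtains F where "y = Poly_Mapping.lookup F" "minimal_support I F"
proof -
  have "y \<in> affine_coeffs I" using assms by (simp add: coeffs.elementary_def)
  then obtain F where "y = Poly_Mapping.lookup F" by (auto simp: affine_coeffs_def)
  with assms that show ?thesis by (simp add: elementary_iff_minimal_support)
qed

lemma minimal_support_unique:
  assumes "minimal_support I F" "minimal_support I G" "Poly_Mapping.keys F = Poly_Mapping.keys G"
  obtains c where "c \<noteq> 0" "G = Poly_Mapping.single 0 c * F"
proof -
  obtain c where c: "c \<noteq> 0" "Poly_Mapping.lookup G = (\<lambda>k. c * Poly_Mapping.lookup F k)"
    using assms coeffs.elementary_unique[of "Poly_Mapping.lookup F" "Poly_Mapping.lookup G"]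
    by (auto simp: elementary_iff_minimal_support supp_lookup)
  then have "G = Poly_Mapping.single 0 c * F"
    by (intro poly_mapping_eqI) (simp add: lookup_const_mult)
  with c(1) that show ?thesis by blast
qed

text \<open>By conformal decomposition the elementary vectors span the coefficient space, and each
  of them belongs to a polynomial of minimal support.\<close>

lemma affine_in_span_minimal:
  assumes "F \<in> I" "total_degree F \<le> 1"
  shows "F \<in> ideal.span {G. minimal_support I G}"
proof -
  let ?S = "ideal.span {G. minimal_support I G}"
  have "Poly_Mapping.lookup F \<in> affine_coeffs I" using assms by (auto simp: affine_coeffs_def)
  \<comment> \<open>The induction runs over coefficient functions, hence the existential form of the
    claim.\<close>
  then have "\<exists>G\<in>?S. Poly_Mapping.lookup F = Poly_Mapping.lookup G"
  proof (induction rule: coeffs.conformal_induct)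
    case zero
    show ?case by (intro bexI[of _ 0]) (auto simp: ideal.span_zero)
  next
    case (elementary y)
    then show ?case by (metis elementaryE ideal.span_base mem_Collect_eq)
  next
    case (scale y c)
    then obtain G where G: "G \<in> ?S" "y = Poly_Mapping.lookup G" by blast
    then show ?case
      by (intro bexI[of _ "Poly_Mapping.single 0 c * G"])
         (auto simp: lookup_const_mult intro: ideal.span_scale)
  next
    case (add y z)
    then obtain G H where "G \<in> ?S" "y = Poly_Mapping.lookup G" "H \<in> ?S" "z = Poly_Mapping.lookup H"
      by blast
    then show ?case
      by (intro bexI[of _ "G + H"]) (auto simp: lookup_add intro: ideal.span_add)
  qed
  then show ?thesis by (simp add: lookup_inject)
qed

text \<open>
  The box is formed in the space of the values of all affine monomials, where they vary independently.
  With the monomial of a minimal term of \<open>F\<close> of sign \<open>1\<close> at \<open>\<plusminus>t\<^bsup>b k\<^esup>\<close> and the others at \<open>\<plusminus>t\<^bsup>a k\<^esup>\<close>, that term strictly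
  dominates; the constant monomial keeps the value \<open>1\<close>, and the inequalities are strict for all others.
\<close>

lemma exists_zero_near:
  fixes a b :: "'n \<Rightarrow> rat"
  assumes p: "\<And>F. minimal_support I F \<Longrightarrow> p \<in> trop_hypersurface F" "p \<in> TR"
    and ab: "\<And>k. of_rat (b k) < snd (p $ k)" "\<And>k. snd (p $ k) < of_rat (a k)"
  obtains z where "\<And>F. F \<in> I \<Longrightarrow> total_degree F \<le> 1 \<Longrightarrow> mpoly_eval F z = 0"
    "\<And>k. z $ k \<noteq> 0" "\<And>k. psign (z $ k) = fst (p $ k)"
    "\<And>k. b k \<le> val (z $ k)" "\<And>k. val (z $ k) \<le> a k"
proof -
  define s :: "'n \<Rightarrow> puiseux" where "s = (\<lambda>k. if fst (p $ k) = 1 then 1 else - 1)"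
  define small where "small = (\<chi> k. s k * tpow (a k))"
  define big where "big = (\<chi> k. s k * tpow (b k))"
  \<comment> \<open>For a negative sign the corner of larger absolute value is the lower end, so the
    order of the two corners depends on the coordinate.\<close>
  define lo where "lo = (\<chi> k. min (small $ k) (big $ k))"
  define hi where "hi = (\<chi> k. max (small $ k) (big $ k))"
  have fst_p: "fst (p $ k) = 1 \<or> fst (p $ k) = - 1" for k
    using p(2) by (auto simp: TR_def)
  have s0: "s k \<noteq> 0" for k by (simp add: s_def)
  have nz: "small $ k \<noteq> 0" "big $ k \<noteq> 0" for k by (simp_all add: small_def big_def s0)
  have sgn: "psign (small $ k) = fst (p $ k)" "psign (big $ k) = fst (p $ k)" for k
    using fst_p[of k] by (auto simp: small_def big_def s_def psign_def order_less_not_sym[OF tpow_pos])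
  have val: "val (small $ k) = a k" "val (big $ k) = b k" for k
    by (auto simp: small_def big_def s_def)
  have "b k < a k" for k
    using order.strict_trans[OF ab, of k] by (simp add: of_rat_less)
  then have tpow_less: "tpow (a k) < tpow (b k)" for k
    by (simp add: less_if_val_less)
  \<comment> \<open>An affine monomial is either the constant 1 or a single coordinate.\<close>
  have bounds: "monomial_eval lo l \<le> monomial_eval hi l"
    "monomial_eval lo l \<le> monomial_eval small l \<and> monomial_eval small l \<le> monomial_eval hi l"
    "monomial_eval lo l \<le> monomial_eval big l \<and> monomial_eval big l \<le> monomial_eval hi l"
    if "l \<in> affine_exponents" for l
    using that by (auto simp: affine_exponents_eq lo_def hi_def)
  have nonneg: "coeffs.box_max affine_exponents (monomial_eval lo) (monomial_eval hi) y \<ge> 0"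
    if "coeffs.elementary y" for y
  proof -
    obtain F where y: "y = Poly_Mapping.lookup F" and F: "minimal_support I F"
      using \<open>coeffs.elementary y\<close> by (rule elementaryE)
    have keys: "Poly_Mapping.keys F \<subseteq> affine_exponents"
      using F by (simp add: minimal_support_def affine_poly_def total_degree_le_1_iff)
    from p(1)[OF F] obtain i where i: "i \<in> Poly_Mapping.keys F" "term_sign F p i = 1"
      "\<And>l. l \<in> Poly_Mapping.keys F \<Longrightarrow> term_val F p i \<le> term_val F p l"
      by (auto simp: trop_hypersurface_iff)
    define x where "x = (\<lambda>l. monomial_eval (if l = i then big else small) l)"
    have "0 < (\<Sum>l\<in>affine_exponents. y l * x l)"
    proof (rule sum_dominated_pos)
      show "i \<in> affine_exponents" using i(1) keys by blast
      have "psign (y i * x i) = term_sign F p i"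
        using i(1) by (simp add: y x_def in_keys_iff psign_mult monomial_eval_nonzero
            psign_monomial_eval nz sgn term_sign_def)
      with i(2) show "0 < y i * x i" by (simp add: psign_def split: if_splits)
      fix l assume l: "l \<in> affine_exponents" "l \<noteq> i" "y l * x l \<noteq> 0"
      then have lF: "l \<in> Poly_Mapping.keys F" by (auto simp: y in_keys_iff)
      have xi: "of_rat (val (y i * x i)) = of_rat (val (y i)) + (\<Sum>k\<in>UNIV. real (i $ k) * of_rat (b k))"
        using i(1) by (simp add: y x_def in_keys_iff val_mult monomial_eval_nonzero nz
            val_monomial_eval val of_rat_add of_rat_sum of_rat_mult)
      have xl: "of_rat (val (y l * x l)) = of_rat (val (y l)) + (\<Sum>k\<in>UNIV. real (l $ k) * of_rat (a k))"
        using lF l(2) by (simp add: y x_def in_keys_iff val_mult monomial_eval_nonzero nz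
            val_monomial_eval val of_rat_add of_rat_sum of_rat_mult)
      have le: "(\<Sum>k\<in>UNIV. real (i $ k) * of_rat (b k)) \<le> (\<Sum>k\<in>UNIV. real (i $ k) * snd (p $ k))"
        "(\<Sum>k\<in>UNIV. real (l $ k) * snd (p $ k)) \<le> (\<Sum>k\<in>UNIV. real (l $ k) * of_rat (a k))"
        by (intro sum_mono mult_left_mono of_nat_0_le_iff order_less_imp_le[OF ab(1)]
            order_less_imp_le[OF ab(2)])+
      have strict: "(\<Sum>k\<in>UNIV. real (m $ k) * u k) < (\<Sum>k\<in>UNIV. real (m $ k) * v k)"
        if m: "m \<noteq> 0" and uv: "\<And>k. u k < v k" for m :: "'n exponent" and u v :: "'n \<Rightarrow> real"
      proof -
        from m obtain k where "m $ k \<noteq> 0" by (auto simp: vec_eq_iff)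
        then have "\<exists>k\<in>UNIV. real (m $ k) * u k < real (m $ k) * v k"
          using uv by (intro bexI[of _ k]) auto
        then show ?thesis
          using uv by (intro sum_strict_mono_ex1) (auto intro!: mult_left_mono less_imp_le[OF uv])
      qed
      \<comment> \<open>At least one of the two distinct monomials is not constant, and its
        valuation moves strictly in the favourable direction.\<close>
      have "i \<noteq> 0 \<or> l \<noteq> 0" using l(2) by auto
      then have "(\<Sum>k\<in>UNIV. real (i $ k) * of_rat (b k)) < (\<Sum>k\<in>UNIV. real (i $ k) * snd (p $ k)) \<or>
        (\<Sum>k\<in>UNIV. real (l $ k) * snd (p $ k)) < (\<Sum>k\<in>UNIV. real (l $ k) * of_rat (a k))"
        using strict[of i "\<lambda>k. of_rat (b k)" "\<lambda>k. snd (p $ k)"]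
          strict[of l "\<lambda>k. snd (p $ k)" "\<lambda>k. of_rat (a k)"] ab by blast
      with le i(3)[OF lF, unfolded term_val_def, folded y] have "(of_rat (val (y i * x i)) :: real) < of_rat (val (y l * x l))"
        unfolding xi xl by linarith
      then show "val (y i * x i) < val (y l * x l)" by (simp add: of_rat_less)
    qed (rule finite_affine_exponents)
    also have "(\<Sum>l\<in>affine_exponents. y l * x l)
        \<le> coeffs.box_max affine_exponents (monomial_eval lo) (monomial_eval hi) y"
      using bounds by (intro coeffs.box_max_ge) (auto simp: x_def)
    finally show ?thesis by simp
  qed
  obtain x where x: "\<And>l. l \<in> affine_exponents \<Longrightarrow> monomial_eval lo l \<le> x l \<and> x l \<le> monomial_eval hi l"
    "\<And>y. y \<in> affine_coeffs I \<Longrightarrow> (\<Sum>l\<in>affine_exponents. y l * x l) = 0"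
    by (rule coeffs.rockafellar[OF bounds(1) nonneg]) (assumption | rule that)+
  \<comment> \<open>Both corners give the constant monomial the value 1, so \<open>x 0 = 1\<close>
    and \<open>x\<close> is the vector of affine monomials of an actual point.\<close>
  define z where "z = (\<chi> k. x (axis k 1))"
  have xz: "x l = monomial_eval z l" if "l \<in> affine_exponents" for l
    using that x(1)[OF that] by (auto simp: affine_exponents_eq z_def)
  have z: "lo $ k \<le> z $ k" "z $ k \<le> hi $ k" for k
    using x(1)[of "axis k 1"] by (auto simp: affine_exponents_eq z_def)
  \<comment> \<open>Up to the common sign, each coordinate lies between two powers of t, and the
    valuation weakly reverses the order of positive elements.\<close>
  have between: "psign (z $ k) = fst (p $ k) \<and> z $ k \<noteq> 0 \<and> b k \<le> val (z $ k) \<and> val (z $ k) \<le> a k" for k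
  proof (cases "fst (p $ k) = 1")
    case True
    then have "tpow (a k) \<le> z $ k" "z $ k \<le> tpow (b k)"
      using z[of k] tpow_less[of k] by (auto simp: lo_def hi_def small_def big_def s_def)
    moreover from this(1) have "0 < z $ k" using tpow_pos order_less_le_trans by blast
    ultimately show ?thesis
      using True val_antimono[of "tpow (a k)" "z $ k"] val_antimono[of "z $ k" "tpow (b k)"]
      by (simp add: psign_def)
  next
    case False
    then have "tpow (a k) \<le> - z $ k" "- z $ k \<le> tpow (b k)"
      using z[of k] tpow_less[of k] by (auto simp: lo_def hi_def small_def big_def s_def)
    moreover from this(1) have "0 < - z $ k" using tpow_pos order_less_le_trans by blast
    ultimately show ?thesis
      using False fst_p[of k] val_antimono[of "tpow (a k)" "- z $ k"]
        val_antimono[of "- z $ k" "tpow (b k)"]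
      by (simp add: psign_def)
  qed
  have "mpoly_eval F z = 0" if F: "F \<in> I" "total_degree F \<le> 1" for F
  proof -
    have "mpoly_eval F z = (\<Sum>l\<in>affine_exponents. Poly_Mapping.lookup F l * x l)"
      using F(2) by (simp add: mpoly_eval_superset[OF finite_affine_exponents] total_degree_le_1_iff xz)
    also have "\<dots> = 0" using F by (intro x(2)) (auto simp: affine_coeffs_def)
    finally show ?thesis .
  qed
  with between that show ?thesis by blast
qed

end

text \<open>The neighbourhood contains a product of open sets, in which the signs of
  \<open>p\<close> can be kept. The bounds are rational because they become exponents of t.\<close>

lemma open_TR_neighbourhood:
  fixes p :: "'n::finite trop_point"
  assumes "open U" "p \<in> U"
  obtains a b :: "'n \<Rightarrow> rat" where
    "\<And>k. of_rat (b k) < snd (p $ k)" "\<And>k. snd (p $ k) < of_rat (a k)"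
    "\<forall>q. (\<forall>k. fst (q $ k) = fst (p $ k) \<and> of_rat (b k) \<le> snd (q $ k) \<and> snd (q $ k) \<le> of_rat (a k)) \<longrightarrow> q \<in> U"
proof -
  obtain A where A: "\<And>k. open (A k)" "\<And>k. p $ k \<in> A k" "\<And>q. (\<And>k. q $ k \<in> A k) \<Longrightarrow> q \<in> U"
    using assms unfolding open_vec_def by metis
  have "\<exists>b a. real_of_rat b < snd (p $ k) \<and> snd (p $ k) < of_rat a \<and>
      (\<forall>y. of_rat b \<le> y \<and> y \<le> of_rat a \<longrightarrow> (fst (p $ k), y) \<in> A k)" for k
  proof -
    obtain C D where CD: "open C" "open D" "p $ k \<in> C \<times> D" "C \<times> D \<subseteq> A k"
      by (rule open_prod_elim[OF A(1)[of k] A(2)[of k]])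
    then have "snd (p $ k) \<in> D" by (simp add: mem_Times_iff)
    with CD(2) obtain e where e: "e > 0" "ball (snd (p $ k)) e \<subseteq> D"
      by (meson open_contains_ball)
    obtain b where b: "snd (p $ k) - e < of_rat b" "of_rat b < snd (p $ k)"
      using of_rat_dense[of "snd (p $ k) - e" "snd (p $ k)"] e(1) by auto
    obtain a where a: "snd (p $ k) < of_rat a" "of_rat a < snd (p $ k) + e"
      using of_rat_dense[of "snd (p $ k)" "snd (p $ k) + e"] e(1) by auto
    have "(fst (p $ k), y) \<in> A k" if "of_rat b \<le> y" "y \<le> of_rat a" for y
    proof -
      have "y \<in> ball (snd (p $ k)) e" using that a b by (simp add: dist_real_def)
      with e(2) CD(3,4) show ?thesis by (auto simp: mem_Times_iff)
    qed
    with a b show ?thesis by blast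
  qed
  then obtain a b :: "'n \<Rightarrow> rat" where ab: "\<And>k. of_rat (b k) < snd (p $ k)" "\<And>k. snd (p $ k) < of_rat (a k)"
      "\<And>k y. of_rat (b k) \<le> y \<Longrightarrow> y \<le> of_rat (a k) \<Longrightarrow> (fst (p $ k), y) \<in> A k"
    by metis
  show ?thesis
  proof (rule that[of b a], goal_cases)
    case 3
    show ?case
    proof (intro allI impI A(3))
      fix q :: "'n trop_point" and k
      assume "\<forall>k. fst (q $ k) = fst (p $ k) \<and> of_rat (b k) \<le> snd (q $ k) \<and> snd (q $ k) \<le> of_rat (a k)"
      then show "q $ k \<in> A k" using ab(3)[of k "snd (q $ k)"] by (metis prod.collapse)
    qed
  qed (use ab in auto)
qed


section \<open>The real tropical basis\<close>

theorem theorem3p13: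
  fixes V :: "(puiseux ^ 'n) set" and I :: "'n mpoly set"
  assumes "affine_space V" and "I = affine_ideal V"
  shows "(\<forall>F G. minimal_support I F \<and> minimal_support I G \<and> Poly_Mapping.keys F = Poly_Mapping.keys G \<longrightarrow>
            (\<exists>c. c \<noteq> 0 \<and> G = Poly_Mapping.single 0 c * F)) \<and>
         (\<forall>B. B \<subseteq> {F. minimal_support I F} \<and>
            bij_betw Poly_Mapping.keys B (Poly_Mapping.keys ` {F. minimal_support I F}) \<longrightarrow> real_tropical_basis B I)"
proof (intro conjI allI impI)
  define S where "S = {F :: 'n mpoly. total_degree F \<le> 1 \<and> (\<forall>x\<in>V. mpoly_eval F x = 0)}"
  have span: "I = ideal.span S" using assms(2) by (simp add: affine_ideal_def S_def)
  then have I: "ideal.subspace I" by simp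
  show "\<exists>c. c \<noteq> 0 \<and> G = Poly_Mapping.single 0 c * F"
    if "minimal_support I F \<and> minimal_support I G \<and> Poly_Mapping.keys F = Poly_Mapping.keys G" for F G
  proof -
    from that have "minimal_support I F" "minimal_support I G" "Poly_Mapping.keys F = Poly_Mapping.keys G"
      by simp_all
    then obtain c where "c \<noteq> 0" "G = Poly_Mapping.single 0 c * F"
      by (rule minimal_support_unique[OF I])
    then show ?thesis by blast
  qed
  fix B
  assume B: "B \<subseteq> {F. minimal_support I F} \<and>
    bij_betw Poly_Mapping.keys B (Poly_Mapping.keys ` {F. minimal_support I F})"
  \<comment> \<open>Every minimal support is represented in \<open>B\<close>, and a polynomial is
    determined by its minimal support up to a constant.\<close>
  have multiple: "\<exists>c G. c \<noteq> 0 \<and> G \<in> B \<and> F = Poly_Mapping.single 0 c * G" if F: "minimal_support I F" for F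
  proof -
    have "Poly_Mapping.keys F \<in> Poly_Mapping.keys ` B"
      using B F by (auto simp: bij_betw_def)
    then obtain G where G: "G \<in> B" "Poly_Mapping.keys G = Poly_Mapping.keys F" by auto
    with B have "minimal_support I G" by blast
    then obtain c where "c \<noteq> 0" "F = Poly_Mapping.single 0 c * G"
      using F G(2) by (rule minimal_support_unique[OF I])
    with G(1) show ?thesis by blast
  qed
  have BI: "B \<subseteq> I" using B by (auto simp: minimal_support_def)
  have "finite B"
  proof (rule finite_imageD)
    show "inj_on Poly_Mapping.keys B" using B by (simp add: bij_betw_def)
    have "Poly_Mapping.keys ` B \<subseteq> Pow affine_exponents"
      using B by (auto simp: minimal_support_def affine_poly_def total_degree_le_1_iff)
    then show "finite (Poly_Mapping.keys ` B)"
      by (rule finite_subset) (simp add: finite_affine_exponents)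
  qed
  moreover have "ideal.span B = I"
  proof
    show "ideal.span B \<subseteq> I" by (rule ideal.span_minimal[OF BI I])
    have "{G. minimal_support I G} \<subseteq> ideal.span B"
      using multiple by (auto intro: ideal.span_scale ideal.span_base)
    then have "ideal.span {G. minimal_support I G} \<subseteq> ideal.span B"
      by (intro ideal.span_minimal) auto
    moreover have "S \<subseteq> ideal.span {G. minimal_support I G}"
      using affine_in_span_minimal[OF I] by (auto simp: S_def span ideal.span_base)
    ultimately show "I \<subseteq> ideal.span B"
      unfolding span by (intro ideal.span_minimal) auto
  qed
  moreover have "trop_variety I = TR \<inter> (\<Inter>F\<in>B. trop_hypersurface F)"
  proof
    \<comment> \<open>For empty \<open>B\<close> the intersection over \<open>B\<close> is the whole
      type, and cutting with \<open>TR\<close> leaves \<open>TR\<close>.\<close>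
    have closed: "closedin (top_of_set TR) (TR \<inter> (\<Inter>F\<in>B. trop_hypersurface F))"
    proof (cases "B = {}")
      case False
      then show ?thesis
        by (intro closedin_Int closedin_INT closed_trop_hypersurface) auto
    qed auto
    have "trop z \<in> trop_hypersurface F" if "z \<in> zeros I" "\<And>k. z $ k \<noteq> 0" "F \<in> B" for z F
      using that B BI by (intro trop_in_hypersurface) (auto simp: zeros_def minimal_support_def affine_poly_def)
    moreover have "trop z \<in> TR" for z :: "puiseux ^ 'n"
      by (simp add: TR_def trop_def psign_def)
    ultimately show "trop_variety I \<subseteq> TR \<inter> (\<Inter>F\<in>B. trop_hypersurface F)"
      unfolding trop_variety_def by (intro closure_of_minimal closed) auto
    show "TR \<inter> (\<Inter>F\<in>B. trop_hypersurface F) \<subseteq> trop_variety I"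
    proof
      fix p assume p: "p \<in> TR \<inter> (\<Inter>F\<in>B. trop_hypersurface F)"
      have pF: "p \<in> trop_hypersurface F" if F: "minimal_support I F" for F
        using multiple[OF F] p trop_hypersurface_const_mult by blast
      have "\<exists>q\<in>trop ` {x \<in> zeros I. \<forall>k. x $ k \<noteq> 0}. q \<in> T"
        if T: "p \<in> T" "openin (top_of_set TR) T" for T
      proof -
        from T(2) obtain U where U: "open U" "T = TR \<inter> U" by (auto simp: openin_open)
        with T(1) have "p \<in> U" by simp
        obtain a b where ab: "\<And>k. of_rat (b k) < snd (p $ k)" "\<And>k. snd (p $ k) < of_rat (a k)"
          and near: "\<forall>q. (\<forall>k. fst (q $ k) = fst (p $ k) \<and> of_rat (b k) \<le> snd (q $ k) \<and> snd (q $ k) \<le> of_rat (a k)) \<longrightarrow> q \<in> U"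
          by (rule open_TR_neighbourhood[OF U(1) \<open>p \<in> U\<close>]) (rule that)
        obtain z where z: "\<And>F. F \<in> I \<Longrightarrow> total_degree F \<le> 1 \<Longrightarrow> mpoly_eval F z = 0"
          "\<And>k. z $ k \<noteq> 0" "\<And>k. psign (z $ k) = fst (p $ k)"
          "\<And>k. b k \<le> val (z $ k)" "\<And>k. val (z $ k) \<le> a k"
          using exists_zero_near[OF I pF _ ab] p by blast
        \<comment> \<open>The affine polynomials vanish at \<open>z\<close>, and they generate
          \<open>I\<close>.\<close>
        have "z \<in> zeros I"
          unfolding span zeros_span using z(1) by (auto simp: zeros_def S_def span ideal.span_base)
        moreover have "trop z \<in> U"
          using z(3-5) by (intro near[rule_format]) (simp add: trop_def of_rat_less_eq)
        moreover have "trop z \<in> TR" by (simp add: TR_def trop_def psign_def)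
        ultimately show ?thesis using U(2) z(2) by blast
      qed
      with p show "p \<in> trop_variety I" by (auto simp: trop_variety_def in_closure_of)
    qed
  qed
  ultimately show "real_tropical_basis B I" by (simp add: real_tropical_basis_def)
qed

end
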